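(* Let $\{G_n\}_{n\ge 1}$ be the increasing sequence of star metric graphs described in the context, with limit graph $G=(V,E)$. Assume that $F$, $\{h^n\}$ and $K$ satisfy the following. (1) $F:\Omega_G\to\mathbb{R}$ and $M:=\sup_{e\in E}\|F\|_{L^2(e)}<+\infty$; $K\in L^\infty(\Omega_G)$, $c_K:=\inf_{x\in\Omega_G}K(x)>0$, and $K$ is constant along each edge $e\in E$, with value $K(e)$. (2) $K$ has finite range: $K(E)=\{K_i:1\le i\le I\}$ with $K_1,\dots,K_I$ distinct, and with $B_i:=\{e\in E:K(e)=K_i\}$, $$\frac1n\sum_{e\in E_n\cap B_i}K(e)=\frac{\#(E_n\cap B_i)}{n}K_i\xrightarrow[n\to\infty]{}s_iK_i,$$ with $s_i>0$ for all $1\le i\le I$ and $\sum_{i=1}^Is_i=1$. (3) For each $1\le i\le I$ there is $\overline F_i\in L^2(0,1)$ such that $\frac{1}{\#(E_n\cap B_i)}\sum_{e\in E_n\cap B_i}F_e\to\overline F_i$ pointwise almost everywhere in $(0,1)$ as $n\to\infty$. (4) The sequence $\{\tfrac1nh^n:n\in\mathbb{N}\}$ is convergent, with limit $\overline h$. For each $n$ let $p^n\in H^1_0(G_n)$ be the solution of the $n$-stage problem, and let $\mathcal{G}$ be the upscaled graph with edges $\sigma_1,\dots,\sigma_I$. Then: (i) The following (homogenized) problem is well-posed: $$\overline p\in H^1_0(\mathcal{G}):\qquad\sum_{i=1}^I\int_{\sigma_i}s_iK_i\,\partial_i\overline p\;\partial_iq=\sum_{i=1}^I\int_0^1s_i\,\overline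 F_i\,q_i+\overline h\,q(0)\qquad\forall\,q\in H^1_0(\mathcal{G}).$$ (ii) With $\overline p$ the solution of the problem in (i), the sequence $\{p^n:n\in\mathbb{N}\}$ satisfies $$\Big\|\frac{1}{\#(E_n\cap B_i)}\sum_{e\in E_n\cap B_i}p^n_e-\overline p_i\Big\|_{H^1(0,1)}\xrightarrow[n\to\infty]{}0\qquad\forall\,1\le i\le I.$$ (iii) The limit function $p:\Omega_G\to\mathbb{R}$ satisfies $$\Big\|\frac{1}{\#(E_n\cap B_i)}\sum_{e\in E_n\cap B_i}p_e-\overline p_i\Big\|_{H^1(0,1)}\xrightarrow[n\to\infty]{}0\qquad\forall\,1\le i\le I,$$ and $$\Big\|\frac1n\sum_{e\in E_n}p_e-\sum_{i=1}^Is_i\,\overline p_i\Big\|_{H^1(0,1)}\xrightarrow[n\to\infty]{}0.$$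
   Context: Star graphs. Let $\{v_n:n\ge1\}$ be a sequence of pairwise distinct points of the unit circle $S^1\subset\mathbb{R}^2$, equidistributed in $S^1$ (the proportion of the first $n$ points lying in any given arc converges, as $n\to\infty$, to the length of the arc divided by $2\pi$), and let $v_0:=0\in\mathbb{R}^2$. For $n\ge1$ let $G_n=(V_n,E_n)$ with $V_n=\{v_i:0\le i\le n\}$ and $E_n=\{v_0v_i:1\le i\le n\}$, where $v_0v_i$ is the straight segment (of length 1) joining $v_0$ and $v_i$; so $\#E_n=n$. The limit graph is $G=(V,E)$ with $V=\bigcup_nV_n$, $E=\bigcup_nE_n$. Put $\Omega_G=\bigcup_{e\in E}\operatorname{int}(e)$ and $\Omega_n=\bigcup_{e\in E_n}\operatorname{int}(e)$. Notation. An edge $e=v_0v_e$ with $v_e=(\cos\theta_e,\sin\theta_e)$ is parametrized by $t\in(0,1)\mapsto(t\cos\theta_e,t\sin\theta_e)$, oriented from $v_0$ to $v_e$; $\partial_e$ is the derivative along $e$ in this direction. For a function $f$ on $\Omega_G$ or $\Omega_n$, $f_e(t):=f(t\cos\theta_e,t\sin\theta_e)$, a function on $(0,1)$. $L^2(e)$, $H^1(e)$, $H^2(e)$ are identified with the corresponding spaces on $(0,1)$. Averages over $E_n\cap B_i$ are considered only for those $n$ with $E_n\cap B_i\neq\emptyset$ (all sufficiently large $n$). Function spaces. $H^1(G_n)$ is the space of $f\in\bigoplus_{e\in E_n}H^1(e)$ whose limits at $v_0$ along all edges coincide; the common value is $f(v_0)=f(0)$. $H^1_0(G_n)$ is the subspace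 of those $f\in H^1(G_n)$ with $f(v_i)=0$ for $1\le i\le n$. The $n$-stage problem. With $\{h^n\}$ a sequence of real numbers, $p^n$ is the unique function such that $$p^n\in H^1_0(G_n):\qquad \sum_{e\in E_n}\int_eK\,\partial_ep^n\,\partial_eq=\sum_{e\in E_n}\int_eF\,q+h^n\,q(v_0)\qquad\forall\,q\in H^1_0(G_n).$$ Upscaled graph. With $I=\#K(E)$, let $w_0:=v_0=0$, $w_i:=(\cos(\tfrac{2\pi}{I}i),\sin(\tfrac{2\pi}{I}i))\in S^1$ and $\sigma_i:=w_0w_i$ (unit segment) for $1\le i\le I$; $\mathcal{G}:=(\mathcal{V},\mathcal{E})$ with $\mathcal{V}=\{w_i:0\le i\le I\}$, $\mathcal{E}=\{\sigma_i:1\le i\le I\}$. For a function $f$ on $\mathcal{G}$, $f_i(t):=f(t\cos(\tfrac{2\pi}{I}i),t\sin(\tfrac{2\pi}{I}i))$, $t\in(0,1)$, and $\partial_i$ is the derivative along $\sigma_i$ oriented from $w_0$ to $w_i$. $H^1_0(\mathcal{G})$ is the space of $f\in\bigoplus_{i=1}^IH^1(\sigma_i)$ whose limits at $w_0$ along all edges coincide (common value $f(0)$) and with $f(w_i)=0$ for $1\le i\le I$, with inner product $\sum_i\int_0^1(f_ig_i+\partial_if\,\partial_ig)$. Well-posed means: there is exactly one solution, and it depends continuously on the data (here $(\overline F_i)_{i}\in L^2(0,1)^I$ and $\overline h\in\mathbb{R}$). Limit function. Under hypotheses (1)–(4), for each $e\in E$ the restrictions of $p^n$ to $e$ (for $n$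 with $e\in E_n$) converge in $H^1(e)$ as $n\to\infty$ to a limit $p^{(e)}\in H^1(e)$; the limit function $p:\Omega_G\to\mathbb{R}$ is the function whose restriction to each edge $e\in E$ is $p^{(e)}$, and $p_e$ is that restriction viewed on $(0,1)$. *)

theory Defs
  imports "HOL-Analysis.Analysis"
begin

section \<open>The spaces \<open>L\<^sup>2(0,1)\<close> and \<open>H\<^sup>1(0,1)\<close>\<close>

text \<open>Elements of these spaces are represented by functions; two functions stand for the same
  element iff they agree almost everywhere in the open unit interval.\<close>

abbreviation leb01 :: "real measure" where
  "leb01 \<equiv> lebesgue_on {0<..<1}"

definition L2 :: "(real \<Rightarrow> real) set" where
  "L2 = {f. f \<in> borel_measurable leb01 \<and> integrable leb01 (\<lambda>t. (f t)\<^sup>2)}"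

definition L2_norm :: "(real \<Rightarrow> real) \<Rightarrow> real" where
  "L2_norm f = sqrt (LINT t|leb01. (f t)\<^sup>2)"

text \<open>Weak derivatives are taken with \<open>C\<^sup>1\<close> test functions of compact support in the open interval,
  as in Brezis, \<^emph>\<open>Functional Analysis, Sobolev Spaces and PDEs\<close>, Section 8.2 (smooth test functions
  give the same notion).\<close>

definition has_weak_deriv :: "(real \<Rightarrow> real) \<Rightarrow> (real \<Rightarrow> real) \<Rightarrow> bool" where
  "has_weak_deriv f g \<longleftrightarrow>
     (\<forall>\<phi> \<phi>'. (\<forall>t. (\<phi> has_real_derivative \<phi>' t) (at t)) \<and> continuous_on UNIV \<phi>' \<and>
             (\<exists>a b. 0 < a \<and> b < 1 \<and> (\<forall>t. \<phi> t \<noteq> 0 \<longrightarrow> a \<le> t \<and> t \<le> b)) \<longrightarrow>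
        (LINT t|leb01. f t * \<phi>' t) = - (LINT t|leb01. g t * \<phi> t))"

definition H1 :: "(real \<Rightarrow> real) set" where
  "H1 = {f \<in> L2. \<exists>g \<in> L2. has_weak_deriv f g}"

text \<open>For \<open>f \<in> H1\<close> the choice below is determined almost everywhere in the unit interval.\<close>

definition weak_deriv :: "(real \<Rightarrow> real) \<Rightarrow> real \<Rightarrow> real" where
  "weak_deriv f = (SOME g. g \<in> L2 \<and> has_weak_deriv f g)"

definition H1_norm :: "(real \<Rightarrow> real) \<Rightarrow> real" where
  "H1_norm f = sqrt ((LINT t|leb01. (f t)\<^sup>2) + (LINT t|leb01. (weak_deriv f t)\<^sup>2))"

text \<open>\<open>c\<close> is the limit at the endpoint \<open>a\<close> (0 or 1) of the continuous representative of \<open>f\<close>.\<close>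

definition has_trace :: "(real \<Rightarrow> real) \<Rightarrow> real \<Rightarrow> real \<Rightarrow> bool" where
  "has_trace f a c \<longleftrightarrow>
     (\<exists>g. continuous_on {0<..<1} g \<and> (AE t in leb01. g t = f t) \<and>
          (g \<longlongrightarrow> c) (at a within {0<..<1}))"


section \<open>Star graphs in the plane\<close>

definition circle_pt :: "real \<Rightarrow> real^2" where
  "circle_pt \<theta> = vector [cos \<theta>, sin \<theta>]"

text \<open>An arc here is the image of an interval \<open>J\<close> (with or without its endpoints) of length at most
  \<open>2\<pi>\<close>.\<close>

definition equidistributed_circle :: "(nat \<Rightarrow> real^2) \<Rightarrow> bool" where
  "equidistributed_circle v \<longleftrightarrow>
     (\<forall>a J. is_interval J \<and> J \<subseteq> {a..a + 2 * pi} \<longrightarrow>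
        (\<lambda>n. real (card {k \<in> {1..n}. v k \<in> circle_pt ` J}) / real n)
          \<longlonglongrightarrow> measure lborel J / (2 * pi))"

definition star_edge :: "(nat \<Rightarrow> real^2) \<Rightarrow> nat \<Rightarrow> (real^2) set" where
  "star_edge v i = closed_segment (v 0) (v i)"

definition star_edges :: "(nat \<Rightarrow> real^2) \<Rightarrow> nat \<Rightarrow> (real^2) set set" where
  "star_edges v n = star_edge v ` {1..n}"

definition limit_edges :: "(nat \<Rightarrow> real^2) \<Rightarrow> (real^2) set set" where
  "limit_edges v = (\<Union>n. star_edges v n)"

definition limit_domain :: "(nat \<Rightarrow> real^2) \<Rightarrow> (real^2) set" where
  "limit_domain v = (\<Union>e\<in>limit_edges v. rel_interior e)"

text \<open>The endpoint on the unit circle of a unit segment starting at the origin, and the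
  arc-length representation \<open>f\<^sub>e\<close> of \<open>f\<close> along such a segment, oriented away from the origin.\<close>

definition outer_pt :: "(real^2) set \<Rightarrow> real^2" where
  "outer_pt e = (THE x. x \<in> e \<and> norm x = 1)"

definition on_edge :: "(real^2 \<Rightarrow> real) \<Rightarrow> (real^2) set \<Rightarrow> real \<Rightarrow> real" where
  "on_edge f e t = f (t *\<^sub>R outer_pt e)"

text \<open>\<open>L\<^sup>\<infinity>\<close> with respect to length measure on the union of the countably many edges in \<open>Es\<close>.\<close>

definition Linf_edges :: "(real^2) set set \<Rightarrow> (real^2 \<Rightarrow> real) set" where
  "Linf_edges Es = {f. (\<forall>e\<in>Es. on_edge f e \<in> borel_measurable leb01) \<and>
                       (\<exists>C. \<forall>e\<in>Es. AE t in leb01. \<bar>on_edge f e t\<bar> \<le> C)}"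

text \<open>The values of \<open>f\<close> at the vertices themselves play no role: the vertex conditions concern the
  limits along the edges.\<close>

definition star_H1 :: "(real^2) set set \<Rightarrow> (real^2 \<Rightarrow> real) set" where
  "star_H1 Es = {f. (\<forall>e\<in>Es. on_edge f e \<in> H1) \<and> (\<exists>c. \<forall>e\<in>Es. has_trace (on_edge f e) 0 c)}"

definition star_H10 :: "(real^2) set set \<Rightarrow> (real^2 \<Rightarrow> real) set" where
  "star_H10 Es = {f \<in> star_H1 Es. \<forall>e\<in>Es. has_trace (on_edge f e) 1 0}"

definition center_value :: "(real^2) set set \<Rightarrow> (real^2 \<Rightarrow> real) \<Rightarrow> real" where
  "center_value Es f = (THE c. \<forall>e\<in>Es. has_trace (on_edge f e) 0 c)"

definition star_H1_norm :: "(real^2) set set \<Rightarrow> (real^2 \<Rightarrow> real) \<Rightarrow> real" where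
  "star_H1_norm Es f = sqrt (\<Sum>e\<in>Es. (H1_norm (on_edge f e))\<^sup>2)"

definition stage_solution ::
  "(real^2) set set \<Rightarrow> (real^2 \<Rightarrow> real) \<Rightarrow> (real^2 \<Rightarrow> real) \<Rightarrow> real \<Rightarrow> (real^2 \<Rightarrow> real) \<Rightarrow> bool" where
  "stage_solution Es K F h p \<longleftrightarrow>
     p \<in> star_H10 Es \<and>
     (\<forall>q \<in> star_H10 Es.
        (\<Sum>e\<in>Es. LINT t|leb01. on_edge K e t * weak_deriv (on_edge p e) t * weak_deriv (on_edge q e) t)
        = (\<Sum>e\<in>Es. LINT t|leb01. on_edge F e t * on_edge q e t) + h * center_value Es q)"

definition edge_avg :: "(real^2) set set \<Rightarrow> (real^2 \<Rightarrow> real) \<Rightarrow> real \<Rightarrow> real" where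
  "edge_avg Es f t = (\<Sum>e\<in>Es. on_edge f e t) / real (card Es)"

definition is_limit_function ::
  "(nat \<Rightarrow> real^2) \<Rightarrow> (nat \<Rightarrow> real^2 \<Rightarrow> real) \<Rightarrow> (real^2 \<Rightarrow> real) \<Rightarrow> bool" where
  "is_limit_function v pn p \<longleftrightarrow>
     (\<forall>e\<in>limit_edges v. on_edge p e \<in> H1 \<and>
        (\<lambda>n. H1_norm (\<lambda>t. on_edge (pn n) e t - on_edge p e t)) \<longlonglongrightarrow> 0)"


section \<open>The upscaled graph and the homogenized problem\<close>

definition upscaled_vertex :: "nat \<Rightarrow> nat \<Rightarrow> real^2" where
  "upscaled_vertex N i = (if i = 0 then 0 else circle_pt (2 * pi / real N * real i))"

definition upscaled_edge :: "nat \<Rightarrow> nat \<Rightarrow> (real^2) set" where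
  "upscaled_edge N i = star_edge (upscaled_vertex N) i"

definition upscaled_edges :: "nat \<Rightarrow> (real^2) set set" where
  "upscaled_edges N = star_edges (upscaled_vertex N) N"

definition homogenized_solution ::
  "nat \<Rightarrow> (nat \<Rightarrow> real) \<Rightarrow> (nat \<Rightarrow> real) \<Rightarrow> (nat \<Rightarrow> real \<Rightarrow> real) \<Rightarrow> real \<Rightarrow> (real^2 \<Rightarrow> real) \<Rightarrow> bool" where
  "homogenized_solution N s \<kappa> Fb hb p \<longleftrightarrow>
     p \<in> star_H10 (upscaled_edges N) \<and>
     (\<forall>q \<in> star_H10 (upscaled_edges N).
        (\<Sum>i=1..N. LINT t|leb01. s i * \<kappa> i * weak_deriv (on_edge p (upscaled_edge N i)) t
                                   * weak_deriv (on_edge q (upscaled_edge N i)) t)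
        = (\<Sum>i=1..N. LINT t|leb01. s i * Fb i t * on_edge q (upscaled_edge N i) t)
          + hb * center_value (upscaled_edges N) q)"

text \<open>Existence and uniqueness (in the sense of almost everywhere equality on each edge) for all
  data, and continuity of the map from the data in \<open>L\<^sup>2(0,1)\<^sup>N \<times> \<real>\<close> to the solution in
  \<open>H\<^sup>1\<^sub>0\<close> of the upscaled graph.\<close>

definition homogenized_well_posed :: "nat \<Rightarrow> (nat \<Rightarrow> real) \<Rightarrow> (nat \<Rightarrow> real) \<Rightarrow> bool" where
  "homogenized_well_posed N s \<kappa> \<longleftrightarrow>
     (\<forall>Fb hb. (\<forall>i\<in>{1..N}. Fb i \<in> L2) \<longrightarrow>
        (\<exists>p. homogenized_solution N s \<kappa> Fb hb p) \<and>
        (\<forall>p p'. homogenized_solution N s \<kappa> Fb hb p \<and> homogenized_solution N s \<kappa> Fb hb p' \<longrightarrow>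
           (\<forall>i\<in>{1..N}. AE t in leb01.
              on_edge p (upscaled_edge N i) t = on_edge p' (upscaled_edge N i) t)) \<and>
        (\<forall>\<epsilon>>0. \<exists>\<delta>>0. \<forall>Fb' hb' p p'.
           (\<forall>i\<in>{1..N}. Fb' i \<in> L2) \<and>
           sqrt ((\<Sum>i=1..N. (L2_norm (\<lambda>t. Fb' i t - Fb i t))\<^sup>2) + (hb' - hb)\<^sup>2) < \<delta> \<and>
           homogenized_solution N s \<kappa> Fb hb p \<and> homogenized_solution N s \<kappa> Fb' hb' p' \<longrightarrow>
           star_H1_norm (upscaled_edges N) (\<lambda>x. p' x - p x) < \<epsilon>))"

end

theory Submission
  imports Defs
begin

text \<open>On an edge the conductivity is constant, so everything can be solved by two integrations. Write
\<open>prim g\<close> for the primitive of \<open>g\<close> that vanishes at \<open>0\<close>. A function with derivative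
\<open>slope g c = prim (prim g) 1 - prim g - c\<close> and value \<open>c\<close> at the center vanishes at the outer
end and satisfies \<open>- u'' = g\<close>; this is \<open>profile g c\<close>. With \<open>g = F\<^sub>e / K(e)\<close> it is the only
candidate for the solution on \<open>e\<close> once the central value \<open>c\<close> is known, and \<open>c\<close> is fixed by
the balance of fluxes at the center. Hence the solution of the problem on any finite star, with
arbitrary positive weights on the edges, is explicit (\<open>star_problem_iff_profile\<close>), with central
value \<open>(\<Sum> prim (prim F\<^sub>e) 1 + h) / \<Sum> K(e)\<close>. Both the problem on \<open>G\<^sub>n\<close> and the homogenized
problem are of this form.

The map \<open>(g, c) \<mapsto> profile g c\<close> is linear and bounded from \<open>L\<^sup>1(0,1) \<times> \<real>\<close> to \<open>H\<^sup>1(0,1)\<close>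
(\<open>H1_norm_profile_le\<close>). Therefore the average of the solutions over a class \<open>B\<^sub>i\<close> is the profile
of the averaged forcing, and it is enough to prove two convergences. The averaged forcing
converges to its limit in \<open>L\<^sup>1\<close>: it converges almost everywhere and is bounded in \<open>L\<^sup>2\<close>, hence
uniformly integrable (\<open>LINT_abs_diff_tendsto_0\<close>). The central values converge: divided by \<open>n\<close>,
numerator and denominator are combinations of class averages with the weights
\<open>#(E\<^sub>n \<inter> B\<^sub>i) / n \<rightarrow> s\<^sub>i\<close>, and the limit is the central value of the homogenized solution. The
limit function has on each edge the profile with the limiting central value, so its averages are
treated in the same way.

The link to the weak formulation is that a function lies in \<open>H\<^sup>1(0,1)\<close> exactly when it agrees
almost everywhere with \<open>c + prim g\<close> for some \<open>g\<close> in \<open>L\<^sup>2\<close>, and that \<open>g\<close> is then its weak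
derivative (\<open>AE_prim_imp_H1\<close>, \<open>H1_E\<close>). Integration by parts for such functions is Fubini's theorem
on the triangle \<open>s < t\<close> (\<open>LINT_mult_prim\<close>).\<close>


section \<open>Square integrable functions on the unit interval\<close>

lemma space_leb01 [simp]: "space leb01 = {0<..<1}"
  by (simp add: space_restrict_space)

lemma emeasure_leb01_space [simp]: "emeasure leb01 {0<..<1} = 1"
  by (simp add: emeasure_restrict_space)

lemma finite_measure_leb01: "finite_measure leb01"
  by (rule finite_measureI) simp

lemma integrable_const_leb01 [simp]: "integrable leb01 (\<lambda>t. c :: real)"
  by (rule finite_measure.integrable_const[OF finite_measure_leb01])

lemma measure_leb01_space [simp]: "measure leb01 {0<..<1} = 1"
  by (simp add: measure_def)

lemma borel_measurable_leb01I:
  fixes f :: "real \<Rightarrow> 'b :: topological_space"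
  assumes "f \<in> borel_measurable borel"
  shows "f \<in> borel_measurable leb01"
  using assms by (intro measurable_restrict_space1 measurable_completion) simp

lemma AE_leb01I: "(\<And>t. 0 < t \<Longrightarrow> t < 1 \<Longrightarrow> P t) \<Longrightarrow> AE t in leb01. P t"
  by (rule AE_I2) simp

lemma AE_leb01_neq: "AE t in leb01. t \<noteq> a"
proof -
  have "AE t in lebesgue. t \<noteq> a"
    by (rule AE_completion) (rule AE_lborel_singleton)
  then show ?thesis
    by (subst AE_restrict_space_iff) (auto elim!: eventually_mono)
qed

lemma integrable_leb01_mult_bounded:
  fixes w f :: "real \<Rightarrow> real"
  assumes f: "integrable leb01 f" and w: "w \<in> borel_measurable leb01"
    and bd: "\<And>t. 0 < t \<Longrightarrow> t < 1 \<Longrightarrow> \<bar>w t\<bar> \<le> C"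
  shows "integrable leb01 (\<lambda>t. w t * f t)"
proof (rule Bochner_Integration.integrable_bound)
  show "integrable leb01 (\<lambda>t. C * f t)" using f by simp
  show "(\<lambda>t. w t * f t) \<in> borel_measurable leb01"
    using f w by measurable
  show "AE t in leb01. norm (w t * f t) \<le> norm (C * f t)"
  proof (rule AE_leb01I)
    fix t :: real assume "0 < t" "t < 1"
    then have "\<bar>w t\<bar> \<le> \<bar>C\<bar>" using bd[of t] by simp
    then show "norm (w t * f t) \<le> norm (C * f t)"
      by (simp add: abs_mult mult_right_mono)
  qed
qed

lemma integrable_indicator_leb01:
  fixes g :: "real \<Rightarrow> real"
  assumes "integrable leb01 g" "A \<in> sets borel"
  shows "integrable leb01 (\<lambda>s. indicator A s * g s)"
  by (rule integrable_leb01_mult_bounded[OF assms(1), of _ 1])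
     (use assms(2) in \<open>auto intro!: borel_measurable_leb01I simp: indicator_def\<close>)

lemma L2_measurable: "f \<in> L2 \<Longrightarrow> f \<in> borel_measurable leb01"
  and L2_square_integrable: "f \<in> L2 \<Longrightarrow> integrable leb01 (\<lambda>t. (f t)\<^sup>2)"
  by (simp_all add: L2_def)

lemma L2_mult_integrable:
  assumes "f \<in> L2" "g \<in> L2"
  shows "integrable leb01 (\<lambda>t. f t * g t)"
proof (rule Bochner_Integration.integrable_bound)
  show "integrable leb01 (\<lambda>t. (f t)\<^sup>2 + (g t)\<^sup>2)"
    using assms by (simp add: L2_square_integrable)
  show "(\<lambda>t. f t * g t) \<in> borel_measurable leb01"
    using assms[THEN L2_measurable] by measurable
  have "\<bar>x * y\<bar> \<le> x\<^sup>2 + y\<^sup>2" for x y :: real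
  proof -
    have "0 \<le> (\<bar>x\<bar> - \<bar>y\<bar>)\<^sup>2" by simp
    then have "2 * \<bar>x * y\<bar> \<le> x\<^sup>2 + y\<^sup>2" by (simp add: power2_diff abs_mult)
    then show ?thesis using abs_ge_zero[of "x * y"] by linarith
  qed
  then show "AE t in leb01. norm (f t * g t) \<le> norm ((f t)\<^sup>2 + (g t)\<^sup>2)"
    by simp
qed

lemma L2I_bounded:
  assumes "f \<in> borel_measurable leb01" "\<And>t. 0 < t \<Longrightarrow> t < 1 \<Longrightarrow> \<bar>f t\<bar> \<le> C"
  shows "f \<in> L2"
proof -
  have "integrable leb01 f"
    by (rule Bochner_Integration.integrable_bound[of leb01 "\<lambda>t. C"])
       (use assms in \<open>auto intro!: AE_leb01I order_trans[OF _ abs_ge_self]\<close>)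
  from integrable_leb01_mult_bounded[OF this assms] show ?thesis
    using assms(1) by (simp add: L2_def power2_eq_square)
qed

lemma L2_const [simp]: "(\<lambda>t. c) \<in> L2"
  by (simp add: L2_def)

lemma L2_integrable: "f \<in> L2 \<Longrightarrow> integrable leb01 f"
  using L2_mult_integrable[of f "\<lambda>t. 1"] by simp

lemma L2_add: "f \<in> L2 \<Longrightarrow> g \<in> L2 \<Longrightarrow> (\<lambda>t. f t + g t) \<in> L2"
  using L2_mult_integrable[of f g]
  by (auto simp: L2_def power2_sum mult.assoc intro!: Bochner_Integration.integrable_add)

lemma L2_cmult: "f \<in> L2 \<Longrightarrow> (\<lambda>t. c * f t) \<in> L2"
  by (auto simp: L2_def power_mult_distrib)

lemma L2_diff: "f \<in> L2 \<Longrightarrow> g \<in> L2 \<Longrightarrow> (\<lambda>t. f t - g t) \<in> L2"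
  using L2_add[of f "\<lambda>t. (-1) * g t"] L2_cmult[of g "-1"] by simp

lemma L2_divide: "f \<in> L2 \<Longrightarrow> (\<lambda>t. f t / c) \<in> L2"
  using L2_cmult[of f "1/c"] by simp

lemma L2_sum: "(\<And>j. j \<in> J \<Longrightarrow> f j \<in> L2) \<Longrightarrow> (\<lambda>t. \<Sum>j\<in>J. f j t) \<in> L2"
  by (induction J rule: infinite_finite_induct) (auto intro: L2_add)

text \<open>Completeness of Lebesgue measure is what makes this true without assuming that \<open>g\<close> is measurable.\<close>

lemma borel_measurable_leb01_AE_cong:
  fixes f g :: "real \<Rightarrow> real"
  assumes f: "f \<in> borel_measurable leb01" and eq: "AE t in leb01. g t = f t"
  shows "g \<in> borel_measurable leb01"
proof -
  let ?r = "\<lambda>h t. if t \<in> {0<..<1} then h t else 0 :: real"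
  have "?r f \<in> borel_measurable lebesgue"
    using f by (subst borel_measurable_if) auto
  moreover have "AE t in lebesgue. ?r f t = ?r g t"
    using eq by (subst (asm) AE_restrict_space_iff) (auto elim!: eventually_mono)
  ultimately have "?r g \<in> borel_measurable lebesgue"
    by (rule borel_measurable_AE)
  then show ?thesis by (subst (asm) borel_measurable_if) auto
qed

lemma L2_AE_cong: "f \<in> L2 \<Longrightarrow> AE t in leb01. g t = f t \<Longrightarrow> g \<in> L2"
  unfolding L2_def
proof safe
  assume f: "f \<in> borel_measurable leb01" "integrable leb01 (\<lambda>t. (f t)\<^sup>2)"
    and eq: "AE t in leb01. g t = f t"
  show g: "g \<in> borel_measurable leb01"
    using f(1) eq by (rule borel_measurable_leb01_AE_cong)
  show "integrable leb01 (\<lambda>t. (g t)\<^sup>2)"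
    by (rule integrable_cong_AE_imp[OF f(2)]) (use g eq in \<open>auto elim!: eventually_mono\<close>)
qed

text \<open>The unit interval has measure one, so the squared right-hand side minus the squared left-hand side
is the variance of \<open>\<bar>f\<bar>\<close>.\<close>

lemma LINT_abs_le_L2_norm: 
  assumes "f \<in> L2"
  shows "(LINT t|leb01. \<bar>f t\<bar>) \<le> L2_norm f"
proof -
  let ?m = "LINT t|leb01. \<bar>f t\<bar>"
  have i: "integrable leb01 (\<lambda>t. \<bar>f t\<bar>)" using L2_integrable[OF assms] by simp
  have "0 \<le> (LINT t|leb01. (\<bar>f t\<bar> - ?m)\<^sup>2)" by simp
  also have "\<dots> = (LINT t|leb01. (f t)\<^sup>2 - 2 * ?m * \<bar>f t\<bar> + ?m\<^sup>2)"
    by (rule arg_cong[of _ _ "integral\<^sup>L leb01"]) (auto simp: power2_diff)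
  also have "\<dots> = (LINT t|leb01. (f t)\<^sup>2) - ?m\<^sup>2"
    using i L2_square_integrable[OF assms] by (simp add: power2_eq_square)
  finally have "?m\<^sup>2 \<le> (LINT t|leb01. (f t)\<^sup>2)" by simp
  then show ?thesis unfolding L2_norm_def by (rule real_le_rsqrt)
qed

text \<open>The sets on which \<open>g\<close> integrates to zero form a Dynkin system that contains the open intervals,
hence all Borel sets; a Lebesgue set differs from a Borel set by a null set only.\<close>

lemma AE_zero_of_intervals:
  fixes g :: "real \<Rightarrow> real"
  assumes g: "integrable leb01 g"
    and zero: "\<And>a b. 0 < a \<Longrightarrow> a < b \<Longrightarrow> b < 1 \<Longrightarrow> (LINT t|leb01. indicator {a<..<b} t * g t) = 0"
  shows "AE t in leb01. g t = 0"
proof (rule sigma_finite_measure.density_zero[OF finite_measure.axioms(1)[OF finite_measure_leb01] g])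
  have ig: "integrable leb01 (\<lambda>t. indicator A t * g t)" if "A \<in> sets borel" for A
    by (rule integrable_leb01_mult_bounded[OF g, of _ 1])
       (use that in \<open>auto intro!: borel_measurable_leb01I simp: indicator_def\<close>)
  (* A limit along sets that agree with A eventually at each point: needed to exhaust an interval by
     compactly contained ones, and for countable unions. *)
  have lim: "(LINT t|leb01. indicator A t * g t) = 0"
    if A: "A \<in> sets borel" and An: "\<And>n. An n \<in> sets borel" 
      "\<And>n. (LINT t|leb01. indicator (An n) t * g t) = 0"
      "\<And>t. 0 < t \<Longrightarrow> t < 1 \<Longrightarrow> \<forall>\<^sub>F n in sequentially. (t \<in> An n) = (t \<in> A)" for A and An :: "nat \<Rightarrow> real set"
  proof -
    have "(\<lambda>n. LINT t|leb01. indicator (An n) t * g t) \<longlonglongrightarrow> (LINT t|leb01. indicator A t * g t)"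
    proof (rule integral_dominated_convergence[where w = "\<lambda>t. \<bar>g t\<bar>"])
      show "AE t in leb01. (\<lambda>n. indicator (An n) t * g t) \<longlonglongrightarrow> indicator A t * g t"
      proof (rule AE_leb01I)
        fix t :: real assume "0 < t" "t < 1"
        from An(3)[OF this] show "(\<lambda>n. indicator (An n) t * g t) \<longlonglongrightarrow> indicator A t * g t"
          by (intro tendsto_eventually) (auto elim!: eventually_mono simp: indicator_def)
      qed
      show "AE t in leb01. norm (indicator (An n) t * g t) \<le> \<bar>g t\<bar>" for n
        by (auto simp: indicator_def)
    qed (use g ig[OF A] ig[OF An(1)] in auto)
    then show ?thesis by (simp add: An(2) LIMSEQ_const_iff)
  qed
  have box: "(LINT t|leb01. indicator {a<..<b} t * g t) = 0" for a b
  proof -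
    let ?a = "\<lambda>n. max a (inverse (real (Suc n)))"
    let ?b = "\<lambda>n. min b (1 - inverse (real (Suc n)))"
    show ?thesis
    proof (rule lim[of "{a<..<b}" "\<lambda>n. {?a n<..<?b n}"])
      fix n
      have pos: "0 < inverse (real (Suc n))" by simp
      show "(LINT t|leb01. indicator {?a n<..<?b n} t * g t) = 0"
      proof (cases "?a n < ?b n")
        case False
        then have e: "{?a n<..<?b n} = {}" by (simp only: greaterThanLessThan_empty_iff not_less)
        show ?thesis unfolding e by simp
      next
        case True
        show ?thesis
        proof (rule zero[OF _ True])
          show "0 < ?a n" using pos by (metis less_max_iff_disj)
          show "?b n < 1" using pos by (metis diff_less_eq less_add_same_cancel1 min_less_iff_disj)
        qed
      qed
    next
      fix t :: real assume t: "0 < t" "t < 1"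
      have "\<forall>\<^sub>F n in sequentially. inverse (real (Suc n)) < min t (1 - t)"
        using t by (intro order_tendstoD(2)[OF LIMSEQ_inverse_real_of_nat]) auto
      then show "\<forall>\<^sub>F n in sequentially. (t \<in> {?a n<..<?b n}) = (t \<in> {a<..<b})"
        proof eventually_elim
        case (elim n)
        have "x < min t (1 - t) \<Longrightarrow> (t \<in> {max a x<..<min b (1 - x)}) = (t \<in> {a<..<b})" for x
          by auto
        then show ?case using elim by blast
      qed
    qed simp_all
  qed
  have whole: "(LINT t|leb01. g t) = 0"
  proof -
    have "(LINT t|leb01. g t) = (LINT t|leb01. indicator {0<..<1} t * g t)"
      by (rule Bochner_Integration.integral_cong) auto
    then show ?thesis using box by simp
  qed
  have borel: "(LINT t|leb01. indicator A t * g t) = 0" if "A \<in> sets borel" for A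
  proof -
    have "Int_stable (range (\<lambda>(a, b). box a b :: real set))"
      by (auto simp: Int_stable_def box_Int_box)
    moreover have "(range (\<lambda>(a, b). box a b :: real set)) \<subseteq> Pow UNIV"
      by auto
    moreover have "A \<in> sigma_sets UNIV (range (\<lambda>(a, b). box a b))"
       using that unfolding borel_eq_box by (simp del: box_real)
    ultimately show ?thesis
    proof (induction rule: sigma_sets_induct_disjoint)
      case (basic A) then show ?case using box by (auto simp: box_real)
    next
      case empty then show ?case by simp
    next
      case (compl A)
      then have "A \<in> sets borel" by (simp add: borel_eq_box)
      have "(LINT t|leb01. indicator (UNIV - A) t * g t) = (LINT t|leb01. g t - indicator A t * g t)"
        by (rule Bochner_Integration.integral_cong) (auto simp: indicator_def)
      also have "\<dots> = 0"
        using g ig[OF \<open>A \<in> sets borel\<close>] compl whole by simp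
      finally show ?case .
    next
      case (union F)
      then have F: "F i \<in> sets borel" for i by (simp add: borel_eq_box subset_eq)
      show ?case
      proof (rule lim[of _ "\<lambda>n. \<Union>i<n. F i"])
        fix n
        have "(LINT t|leb01. indicator (\<Union>i<n. F i) t * g t)
            = (LINT t|leb01. (\<Sum>i<n. indicator (F i) t * g t))"
        proof (rule Bochner_Integration.integral_cong[OF refl])
          fix t
          have "indicator (\<Union>i<n. F i) t = (\<Sum>i<n. indicator (F i) t :: real)"
            using union.hyps(1) by (subst indicator_UN_disjoint) (auto simp: disjoint_family_on_def)
          then show "indicator (\<Union>i<n. F i) t * g t = (\<Sum>i<n. indicator (F i) t * g t)"
            by (simp add: sum_distrib_right)
        qed
        also have "\<dots> = (\<Sum>i<n. LINT t|leb01. indicator (F i) t * g t)"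
          by (rule Bochner_Integration.integral_sum) (rule ig[OF F])
        also have "\<dots> = 0" by (simp only: union.IH sum.neutral_const)
        finally show "(LINT t|leb01. indicator (\<Union>i<n. F i) t * g t) = 0" .
      next
        fix t
        show "\<forall>\<^sub>F n in sequentially. (t \<in> (\<Union>i<n. F i)) = (t \<in> (\<Union>i. F i))"
        proof (cases "\<exists>i. t \<in> F i")
          case True
          then obtain i where "t \<in> F i" by blast
          then show ?thesis
            by (intro eventually_mono[OF eventually_gt_at_top[of i]]) blast
        qed simp
      qed (use F in auto)
    qed
  qed
  fix A assume "A \<in> sets leb01"
  then have A: "A \<in> sets lebesgue" "A \<subseteq> {0<..<1}"
    by (auto simp: sets_restrict_space)
  from sets_lebesgue_almost_borel[OF A(1)]
  obtain C T where CT: "C \<in> sets borel" "negligible T" "C \<union> T = A"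
    by blast
  have "AE t in lebesgue. t \<notin> T"
    using CT(2) by (simp add: negligible_iff_null_sets AE_not_in)
  then have "AE t in leb01. t \<notin> T"
    by (subst AE_restrict_space_iff) (auto elim!: eventually_mono)
  then have "AE t in leb01. indicator A t *\<^sub>R g t = indicator C t * g t"
    by eventually_elim (auto simp: CT(3)[symmetric] indicator_def)
  then have "(LINT t|leb01. indicator A t *\<^sub>R g t) = (LINT t|leb01. indicator C t * g t)"
  proof (intro integral_cong_AE)
    show "(\<lambda>t. indicat_real A t *\<^sub>R g t) \<in> borel_measurable leb01"
      using g \<open>A \<in> sets leb01\<close> by measurable
  qed (use ig[OF CT(1)] in auto)
  then show "set_lebesgue_integral leb01 A g = 0"
    using borel[OF CT(1)] by (simp add: set_lebesgue_integral_def)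
qed


section \<open>Primitives of integrable functions\<close>

text \<open>The upper limit enters through an indicator, so that all integrals are over one fixed measure
space, as dominated convergence and Fubini's theorem require.\<close>

definition prim :: "(real \<Rightarrow> real) \<Rightarrow> real \<Rightarrow> real" where
  "prim g t = (LINT s|leb01. indicator {0<..<t} s * g s)"

lemma prim_0 [simp]: "prim g 0 = 0"
  by (simp add: prim_def)

lemma abs_LINT_indicator_le:
  fixes g :: "real \<Rightarrow> real"
  assumes g: "integrable leb01 g" and A: "A \<in> sets borel"
  shows "\<bar>LINT s|leb01. indicator A s * g s\<bar> \<le> (LINT s|leb01. \<bar>g s\<bar>)"
proof -
  have "\<bar>LINT s|leb01. indicator A s * g s\<bar> \<le> (LINT s|leb01. \<bar>indicator A s * g s\<bar>)"
    by (rule integral_abs_bound)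
  also have "\<dots> \<le> (LINT s|leb01. \<bar>g s\<bar>)"
    by (rule integral_mono) (use integrable_indicator_leb01[OF assms] g in \<open>auto simp: indicator_def\<close>)
  finally show ?thesis .
qed

lemma abs_prim_le: "integrable leb01 g \<Longrightarrow> \<bar>prim g t\<bar> \<le> (LINT s|leb01. \<bar>g s\<bar>)"
  unfolding prim_def by (rule abs_LINT_indicator_le) auto

lemma prim_1: "prim g 1 = (LINT s|leb01. g s)"
  unfolding prim_def by (rule Bochner_Integration.integral_cong) auto

lemma prim_cong_AE:
  assumes "f \<in> borel_measurable leb01" "g \<in> borel_measurable leb01" "AE t in leb01. f t = g t"
  shows "prim f t = prim g t"
  unfolding prim_def
proof (rule integral_cong_AE)
  have [measurable]: "indicat_real {0<..<t} \<in> borel_measurable leb01"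
    by (rule borel_measurable_leb01I) simp
  show "(\<lambda>s. indicator {0<..<t} s * f s) \<in> borel_measurable leb01"
    "(\<lambda>s. indicator {0<..<t} s * g s) \<in> borel_measurable leb01"
    using assms(1,2) by measurable
qed (use assms(3) in \<open>auto elim!: eventually_mono\<close>)

lemma prim_diff:
  "integrable leb01 f \<Longrightarrow> integrable leb01 g \<Longrightarrow> prim (\<lambda>t. f t - g t) t = prim f t - prim g t"
  unfolding prim_def by (simp add: right_diff_distrib integrable_indicator_leb01)

lemma prim_cmult: "prim (\<lambda>t. c * f t) t = c * prim f t"
  unfolding prim_def by (simp add: mult.left_commute)

lemma prim_sum:
  assumes "\<And>j. j \<in> J \<Longrightarrow> integrable leb01 (f j)"
  shows "prim (\<lambda>t. \<Sum>j\<in>J. f j t) t = (\<Sum>j\<in>J. prim (f j) t)"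
  unfolding prim_def sum_distrib_left
  by (rule Bochner_Integration.integral_sum) (use assms in \<open>auto intro: integrable_indicator_leb01\<close>)

lemma prim_const:
  assumes "0 \<le> t" "t \<le> 1"
  shows "prim (\<lambda>s. c) t = c * t"
proof -
  have "prim (\<lambda>s. c) t = c * (LINT s|leb01. indicator {0<..<t} s)"
    by (simp add: prim_def)
  also have "(LINT s|leb01. indicator {0<..<t} s) = measure leb01 ({0<..<t} \<inter> {0<..<1})"
    by simp
  also have "{0<..<t} \<inter> {0<..<1} = {0<..<t}" using assms by auto
  also have "measure leb01 {0<..<t} = t"
    using assms by (subst measure_restrict_space) auto
  finally show ?thesis .
qed

lemma LINT_interval_eq_prim_diff:
  assumes "integrable leb01 g" "0 < a" "a < b" "b < 1"
  shows "(LINT t|leb01. indicator {a<..<b} t * g t) = prim g b - prim g a"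
proof -
  have "(LINT t|leb01. indicator {a<..<b} t * g t)
      = (LINT t|leb01. indicator {0<..<b} t * g t - indicator {0<..<a} t * g t)"
  proof (rule integral_cong_AE)
    from AE_leb01_neq[of a] show "AE t in leb01. indicator {a<..<b} t * g t
        = indicator {0<..<b} t * g t - indicator {0<..<a} t * g t"
      by eventually_elim (use assms in \<open>auto simp: indicator_def\<close>)
  qed (use assms in \<open>auto intro!: borel_measurable_integrable integrable_indicator_leb01 Bochner_Integration.integrable_diff\<close>)
  also have "\<dots> = prim g b - prim g a"
    unfolding prim_def using assms by (simp add: integrable_indicator_leb01)
  finally show ?thesis .
qed

lemma continuous_on_prim:
  assumes g: "integrable leb01 g"
  shows "continuous_on UNIV (prim g)"
  unfolding continuous_on_sequentially comp_def
proof (intro allI ballI impI)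
  fix x :: "nat \<Rightarrow> real" and a
  assume x: "(\<forall>n. x n \<in> UNIV) \<and> x \<longlonglongrightarrow> a"
  show "(\<lambda>n. prim g (x n)) \<longlonglongrightarrow> prim g a"
    unfolding prim_def
  proof (rule integral_dominated_convergence[where w = "\<lambda>t. \<bar>g t\<bar>"])
    from AE_leb01_neq[of a] show "AE t in leb01. (\<lambda>n. indicator {0<..<x n} t * g t) \<longlonglongrightarrow> indicator {0<..<a} t * g t"
    proof eventually_elim
      case (elim t)
      have "\<forall>\<^sub>F n in sequentially. (t < x n) = (t < a)"
      proof (cases "t < a")
        case True
        with x show ?thesis by (auto dest: order_tendstoD(1) elim!: eventually_mono)
      next
        case False
        with x elim have "\<forall>\<^sub>F n in sequentially. x n < t"
          by (intro order_tendstoD(2)) auto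
        then show ?thesis using False by (auto elim!: eventually_mono)
      qed
      then show ?case
        by (intro tendsto_eventually) (auto elim!: eventually_mono simp: indicator_def)
    qed
    show "AE t in leb01. norm (indicator {0<..<x n} t * g t) \<le> \<bar>g t\<bar>" for n
      by (auto simp: indicator_def)
  qed (use g integrable_indicator_leb01[OF g] in auto)
qed

lemma prim_measurable: "integrable leb01 g \<Longrightarrow> prim g \<in> borel_measurable leb01"
  by (intro borel_measurable_leb01I borel_measurable_continuous_onI continuous_on_prim)

lemma prim_L2: "integrable leb01 g \<Longrightarrow> prim g \<in> L2"
  by (rule L2I_bounded[OF prim_measurable abs_prim_le])

lemma integrable_prim: "integrable leb01 g \<Longrightarrow> integrable leb01 (prim g)"
  by (rule L2_integrable[OF prim_L2])

lemma abs_prim_prim_le: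
  assumes "integrable leb01 g"
  shows "\<bar>prim (prim g) t\<bar> \<le> (LINT s|leb01. \<bar>g s\<bar>)"
proof -
  have "\<bar>prim (prim g) t\<bar> \<le> (LINT s|leb01. \<bar>prim g s\<bar>)"
    by (rule abs_prim_le[OF integrable_prim[OF assms]])
  also have "\<dots> \<le> (LINT s|leb01. (LINT s|leb01. \<bar>g s\<bar>))"
    by (rule integral_mono) (use integrable_prim[OF assms] abs_prim_le[OF assms] in auto)
  finally show ?thesis by simp
qed

lemma prim_prim_diff:
  assumes "integrable leb01 f" "integrable leb01 g"
  shows "prim (prim (\<lambda>t. f t - g t)) 1 = prim (prim f) 1 - prim (prim g) 1"
proof -
  have "prim (\<lambda>t. f t - g t) = (\<lambda>t. prim f t - prim g t)"
    using assms by (simp add: prim_diff fun_eq_iff)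
  then show ?thesis using assms by (simp add: prim_diff integrable_prim)
qed

lemma prim_prim_cmult: "prim (prim (\<lambda>t. a * f t)) 1 = a * prim (prim f) 1"
proof -
  have "prim (\<lambda>t. a * f t) = (\<lambda>t. a * prim f t)"
    by (simp add: prim_cmult fun_eq_iff)
  then show ?thesis by (simp add: prim_cmult)
qed

lemma prim_prim_sum:
  assumes "\<And>j. j \<in> J \<Longrightarrow> integrable leb01 (f j)"
  shows "prim (prim (\<lambda>t. \<Sum>j\<in>J. f j t)) 1 = (\<Sum>j\<in>J. prim (prim (f j)) 1)"
proof -
  have "prim (\<lambda>t. \<Sum>j\<in>J. f j t) = (\<lambda>t. \<Sum>j\<in>J. prim (f j) t)"
    using assms by (simp add: prim_sum fun_eq_iff)
  then show ?thesis using assms by (simp add: prim_sum integrable_prim)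
qed

text \<open>Integration by parts for primitives: both sides are the integral of \<open>f t * g s\<close> over the triangle
\<open>s < t\<close>, taken in the two possible orders.\<close>

lemma LINT_mult_prim:
  assumes f: "integrable leb01 f" and g: "integrable leb01 g"
  shows "(LINT t|leb01. f t * prim g t) = (LINT s|leb01. g s * (prim f 1 - prim f s))"
proof -
  interpret finite_measure leb01 by (rule finite_measure_leb01)
  interpret P: pair_sigma_finite leb01 leb01 ..
  have [measurable]: "f \<in> borel_measurable leb01" "g \<in> borel_measurable leb01"
    using f g by auto
  have id: "(\<lambda>x. x) \<in> borel_measurable leb01"
    by (rule borel_measurable_leb01I) simp
  have [measurable]: "fst \<in> borel_measurable (leb01 \<Otimes>\<^sub>M leb01)" "snd \<in> borel_measurable (leb01 \<Otimes>\<^sub>M leb01)"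
    using measurable_compose[OF measurable_fst id] measurable_compose[OF measurable_snd id] by auto
  (* The integrand is extended by zero from the triangle to the square. *)
  let ?k = "\<lambda>(t, s). (if s < t then 1 else 0) * (f t * g s)"
  have m: "?k \<in> borel_measurable (leb01 \<Otimes>\<^sub>M leb01)"
    by (simp add: case_prod_beta) measurable
  have "integrable (leb01 \<Otimes>\<^sub>M leb01) ?k"
  proof (rule P.Fubini_integrable[OF m])
    have "integrable leb01 (\<lambda>t. \<bar>f t\<bar> * prim (\<lambda>s. \<bar>g s\<bar>) t)"
      using integrable_leb01_mult_bounded[of "\<lambda>t. \<bar>f t\<bar>", OF _ prim_measurable abs_prim_le] f g
      by (simp add: mult.commute)
    moreover have "(LINT s|leb01. norm (?k (t, s))) = \<bar>f t\<bar> * prim (\<lambda>s. \<bar>g s\<bar>) t" for t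
      unfolding prim_def integral_mult_right_zero[symmetric]
      by (rule Bochner_Integration.integral_cong) (auto simp: indicator_def abs_mult)
    ultimately show "integrable leb01 (\<lambda>t. LINT s|leb01. norm (?k (t, s)))"
      by simp
    show "AE t in leb01. integrable leb01 (\<lambda>s. ?k (t, s))"
    proof (rule AE_I2)
      fix t
      have "integrable leb01 (\<lambda>s. f t * ((if s < t then 1 else 0) * g s))"
        by (intro integrable_mult_right integrable_leb01_mult_bounded[OF g, of _ 1] borel_measurable_leb01I) auto
      then show "integrable leb01 (\<lambda>s. ?k (t, s))" by (simp add: mult.left_commute)
    qed
  qed
  then have "(LINT s|leb01. LINT t|leb01. ?k (t, s)) = (LINT t|leb01. LINT s|leb01. ?k (t, s))"
    using P.Fubini_integral[of "\<lambda>t s. ?k (t, s)"] by (simp add: case_prod_beta)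
  moreover have "(LINT s|leb01. ?k (t, s)) = f t * prim g t" for t
    unfolding prim_def integral_mult_right_zero[symmetric]
    by (rule Bochner_Integration.integral_cong) (auto simp: indicator_def)
  moreover have "(LINT t|leb01. ?k (t, s)) = g s * (prim f 1 - prim f s)" if "s \<in> {0<..<1}" for s
  proof -
    have ae: "AE t in leb01. ?k (t, s) = g s * (f t - indicator {0<..<s} t * f t)"
      using AE_leb01_neq[of s] AE_space by eventually_elim (use that in \<open>auto simp: indicator_def\<close>)
    have m1: "(\<lambda>t. if s < t then 1 else 0 :: real) \<in> borel_measurable leb01"
      by (rule borel_measurable_leb01I) simp
    have m2: "(\<lambda>t. indicator {0<..<s} t * f t) \<in> borel_measurable leb01"
      by (intro borel_measurable_integrable integrable_indicator_leb01[OF f]) simp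
    have "(LINT t|leb01. ?k (t, s)) = (LINT t|leb01. g s * (f t - indicator {0<..<s} t * f t))"
      by (rule integral_cong_AE[OF _ _ ae]) (use m1 m2 in simp_all)
    also have "\<dots> = g s * (prim f 1 - prim f s)"
      unfolding prim_1 prim_def[of f s] integral_mult_right_zero
      by (subst Bochner_Integration.integral_diff) (use f in \<open>auto intro: integrable_indicator_leb01\<close>)
    finally show ?thesis .
  qed
  then have "(LINT s|leb01. LINT t|leb01. ?k (t, s)) = (LINT s|leb01. g s * (prim f 1 - prim f s))"
    by (intro Bochner_Integration.integral_cong) auto
  ultimately show ?thesis by simp
qed


section \<open>Weak derivatives\<close>

text \<open>The test functions of \<^const>\<open>has_weak_deriv\<close>, together with their derivatives.\<close>

definition test_pair :: "(real \<Rightarrow> real) \<Rightarrow> (real \<Rightarrow> real) \<Rightarrow> bool" where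
  "test_pair \<phi> \<phi>' \<longleftrightarrow> (\<forall>t. (\<phi> has_real_derivative \<phi>' t) (at t)) \<and> continuous_on UNIV \<phi>' \<and>
             (\<exists>a b. 0 < a \<and> b < 1 \<and> (\<forall>t. \<phi> t \<noteq> 0 \<longrightarrow> a \<le> t \<and> t \<le> b))"

lemma has_weak_deriv_iff_test_pair:
  "has_weak_deriv f g \<longleftrightarrow>
     (\<forall>\<phi> \<phi>'. test_pair \<phi> \<phi>' \<longrightarrow> (LINT t|leb01. f t * \<phi>' t) = - (LINT t|leb01. g t * \<phi> t))"
  by (simp add: has_weak_deriv_def test_pair_def)

lemma continuous_leb01_bounded:
  fixes f :: "real \<Rightarrow> real"
  assumes "continuous_on UNIV f"
  obtains C where "\<And>t. 0 < t \<Longrightarrow> t < 1 \<Longrightarrow> \<bar>f t\<bar> \<le> C"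
proof -
  have "compact (f ` {0..1})"
    using assms by (intro compact_continuous_image) (auto intro: continuous_on_subset)
  then show ?thesis
    using that by (force dest!: compact_imp_bounded simp: bounded_iff)
qed

lemma continuous_integrable_leb01:
  fixes f :: "real \<Rightarrow> real"
  assumes "continuous_on UNIV f"
  shows "integrable leb01 f" "f \<in> L2"
proof -
  obtain C where C: "\<And>t. 0 < t \<Longrightarrow> t < 1 \<Longrightarrow> \<bar>f t\<bar> \<le> C"
    using continuous_leb01_bounded[OF assms] by blast
  show "f \<in> L2"
    by (rule L2I_bounded[of _ C])
       (use assms C in \<open>auto intro: borel_measurable_leb01I borel_measurable_continuous_onI\<close>)
  then show "integrable leb01 f" by (rule L2_integrable)
qed

lemma prim_derivative:
  assumes deriv: "\<And>t. (\<phi> has_real_derivative \<phi>' t) (at t)" and cont: "continuous_on UNIV \<phi>'"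
    and t: "0 \<le> t" "t \<le> 1"
  shows "prim \<phi>' t = \<phi> t - \<phi> 0"
proof -
  have "prim \<phi>' t = (LINT s|lebesgue. indicator {0<..<1} s *\<^sub>R (indicator {0<..<t} s * \<phi>' s))"
    unfolding prim_def by (subst integral_restrict_space) auto
  also have "\<dots> = (LINT s|lebesgue. indicator {0<..<t} s *\<^sub>R \<phi>' s)"
    using t by (intro Bochner_Integration.integral_cong) (auto simp: indicator_def)
  also have "\<dots> = (LINT s|lebesgue_on {0<..<t}. \<phi>' s)"
    by (subst integral_restrict_space) auto
  also have "\<dots> = integral {0<..<t} \<phi>'"
  proof (rule lebesgue_integral_eq_integral)
    have "integrable leb01 (\<lambda>s. indicator {0<..<t} s * \<phi>' s)"
      by (rule integrable_indicator_leb01[OF continuous_integrable_leb01(1)[OF cont]]) simp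
    then have "integrable lebesgue (\<lambda>s. indicator {0<..<1} s *\<^sub>R (indicator {0<..<t} s * \<phi>' s))"
      by (subst (asm) integrable_restrict_space) auto
    also have "(\<lambda>s. indicator {0<..<1} s *\<^sub>R (indicator {0<..<t} s * \<phi>' s)) = (\<lambda>s. indicator {0<..<t} s *\<^sub>R \<phi>' s)"
      using t by (auto simp: indicator_def)
    finally show "integrable (lebesgue_on {0<..<t}) \<phi>'"
      by (subst integrable_restrict_space) auto
  qed simp
  also have "\<dots> = integral {0..t} \<phi>'"
    by (rule integral_open_interval_real[symmetric])
  also have "(\<phi>' has_integral (\<phi> t - \<phi> 0)) {0..t}"
    using t deriv by (intro fundamental_theorem_of_calculus)
      (auto simp: has_real_derivative_iff_has_vector_derivative[symmetric] intro: has_field_derivative_at_within)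
  then have "integral {0..t} \<phi>' = \<phi> t - \<phi> 0"
    by (rule integral_unique)
  finally show ?thesis .
qed

text \<open>An antiderivative of \<open>v\<close> is constant on either side of \<open>[a, b]\<close>, and the two constants agree
because \<open>v\<close> has mean zero. Thus derivatives of test functions are exactly the continuous functions
of mean zero with compact support in the open interval.\<close>

lemma test_pair_of_mean_zero:
  assumes cont: "continuous_on UNIV v" and supp: "\<And>t. v t \<noteq> 0 \<Longrightarrow> a \<le> t \<and> t \<le> b"
    and ab: "0 < a" "b < 1" and mean: "(LINT t|leb01. v t) = 0"
  obtains \<phi> where "test_pair \<phi> v"
proof -
  have "\<exists>\<Phi>. \<forall>x::real. -\<infinity> < ereal x \<longrightarrow> ereal x < \<infinity> \<longrightarrow> (\<Phi> has_vector_derivative v x) (at x)"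
    by (rule einterval_antiderivative) (use cont in \<open>auto simp: continuous_on_eq_continuous_at\<close>)
  then obtain \<Phi> where \<Phi>: "\<And>t. (\<Phi> has_real_derivative v t) (at t)"
    by (auto simp: has_real_derivative_iff_has_vector_derivative)
  define \<phi> where "\<phi> t = \<Phi> t - \<Phi> 0" for t
  have \<phi>: "(\<phi> has_real_derivative v t) (at t)" for t
    unfolding \<phi>_def using \<Phi>[of t] by (auto intro!: derivative_eq_intros)
  have const: "\<phi> y = \<phi> x" if xy: "x < y" and z: "\<And>t. x < t \<Longrightarrow> t < y \<Longrightarrow> v t = 0" for x y
  proof (rule DERIV_isconst_end[OF xy])
    show "continuous_on {x..y} \<phi>"
      by (rule DERIV_continuous_on) (rule has_field_derivative_at_within[OF \<phi>])
    show "(\<phi> has_real_derivative 0) (at t)" if "x < t" "t < y" for t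
      using \<phi>[of t] z[OF that] by simp
  qed
  have "\<phi> 1 = 0"
    using prim_derivative[OF \<phi> cont, of 1] mean by (simp add: prim_1 \<phi>_def)
  have "\<phi> t = 0" if "t < a" for t
  proof -
    have "\<phi> t = \<phi> (min t 0 - 1)" by (rule const) (use supp that in force)+
    moreover have "\<phi> 0 = \<phi> (min t 0 - 1)" by (rule const) (use supp that ab in force)+
    ultimately show ?thesis by (simp add: \<phi>_def)
  qed
  moreover have "\<phi> t = 0" if "t > b" for t
  proof -
    have "\<phi> (max t 1 + 1) = \<phi> t" by (rule const) (use supp that in force)+
    moreover have "\<phi> (max t 1 + 1) = \<phi> 1" by (rule const) (use supp that ab in force)+
    ultimately show ?thesis using \<open>\<phi> 1 = 0\<close> by simp
  qed
  ultimately have "\<forall>t. \<phi> t \<noteq> 0 \<longrightarrow> a \<le> t \<and> t \<le> b"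
    by (meson linorder_not_less)
  then have "test_pair \<phi> v"
    unfolding test_pair_def using \<phi> cont ab by blast
  then show ?thesis by (rule that)
qed

text \<open>The trapezoid over \<open>[a, b]\<close> with height at most one and flanks of steepness \<open>n\<close>.\<close>

definition hat :: "real \<Rightarrow> real \<Rightarrow> nat \<Rightarrow> real \<Rightarrow> real" where
  "hat a b n t = min 1 (real n * max 0 (min (t - a) (b - t)))"

lemma continuous_on_hat: "continuous_on UNIV (hat a b n)"
  unfolding hat_def by (intro continuous_intros)

lemma hat_bounds: "0 \<le> hat a b n t" "hat a b n t \<le> 1"
  by (auto simp: hat_def)

lemma hat_support: "hat a b n t \<noteq> 0 \<Longrightarrow> a \<le> t \<and> t \<le> b"
  by (auto simp: hat_def max_def min_def split: if_splits)

lemma hat_tendsto_indicator: "(\<lambda>n. hat a b n t) \<longlonglongrightarrow> indicator {a<..<b} t"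
proof (cases "t \<in> {a<..<b}")
  case True
  define d where "d = min (t - a) (b - t)"
  have "d > 0" using True by (auto simp: d_def)
  obtain n0 where n0: "1 / d < real n0" using reals_Archimedean2 by blast
  have "\<forall>\<^sub>F n in sequentially. hat a b n t = 1"
    using eventually_ge_at_top[of n0]
  proof eventually_elim
    case (elim n)
    then have "1 / d < real n" using n0 by linarith
    then have "1 \<le> real n * d" using \<open>d > 0\<close> by (simp add: field_simps)
    then show ?case using \<open>d > 0\<close> by (simp add: hat_def d_def[symmetric])
  qed
  then show ?thesis using True by (simp add: tendsto_eventually)
next
  case False
  then have "min (t - a) (b - t) \<le> 0" by auto
  then have "hat a b n t = 0" for n by (simp add: hat_def max_absorb1)
  then show ?thesis using False by simp
qed

text \<open>Trapezoids are continuous and increase to indicators of intervals, which reduces the fundamental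
lemma of the calculus of variations to the case of intervals.\<close>

lemma AE_zero_of_hats:
  fixes g :: "real \<Rightarrow> real"
  assumes g: "integrable leb01 g"
    and zero: "\<And>a b n. 0 < a \<Longrightarrow> a < b \<Longrightarrow> b < 1 \<Longrightarrow> (LINT t|leb01. hat a b n t * g t) = 0"
  shows "AE t in leb01. g t = 0"
proof (rule AE_zero_of_intervals[OF g])
  fix a b :: real assume ab: "0 < a" "a < b" "b < 1"
  have "(\<lambda>n. LINT t|leb01. hat a b n t * g t) \<longlonglongrightarrow> (LINT t|leb01. indicator {a<..<b} t * g t)"
  proof (rule integral_dominated_convergence[where w = "\<lambda>t. \<bar>g t\<bar>"])
    show "AE t in leb01. (\<lambda>n. hat a b n t * g t) \<longlonglongrightarrow> indicator {a<..<b} t * g t"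
      by (intro AE_I2 tendsto_mult hat_tendsto_indicator tendsto_const)
    show "AE t in leb01. norm (hat a b n t * g t) \<le> \<bar>g t\<bar>" for n
      using hat_bounds[of a b n] by (auto simp: abs_mult mult_left_le_one_le)
    show "(\<lambda>t. hat a b n t * g t) \<in> borel_measurable leb01" for n
      by (intro borel_measurable_times borel_measurable_leb01I borel_measurable_continuous_onI
        continuous_on_hat borel_measurable_integrable[OF g])
  qed (use g integrable_indicator_leb01[OF g] in auto)
  then show "(LINT t|leb01. indicator {a<..<b} t * g t) = 0"
    using zero[OF ab] by (simp add: LIMSEQ_const_iff)
qed

text \<open>The du Bois-Reymond lemma. A trapezoid becomes a derivative of a test function after subtracting a
multiple of one fixed trapezoid \<open>\<psi>\<close> that removes its mean. Hence \<open>f\<close> minus the \<open>\<psi>\<close>-weighted mean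
of \<open>f\<close> is orthogonal to all trapezoids.\<close>

lemma weak_deriv_zero_imp_AE_const:
  fixes f :: "real \<Rightarrow> real"
  assumes f: "integrable leb01 f"
    and zero: "\<And>\<phi> \<phi>'. test_pair \<phi> \<phi>' \<Longrightarrow> (LINT t|leb01. f t * \<phi>' t) = 0"
  obtains C where "AE t in leb01. f t = C"
proof -
  (* Any fixed trapezoid with nonzero mean would do; this one equals 1 on (3/8, 5/8). *)
  let ?\<psi> = "hat (1/4) (3/4) 8"
  have i: "integrable leb01 (hat a b n)" for a b n
    by (rule continuous_integrable_leb01(1)[OF continuous_on_hat])
  have ih: "integrable leb01 (\<lambda>t. hat a b n t * h t)" if "integrable leb01 h" for a b n h
    by (rule integrable_leb01_mult_bounded[OF that, of _ 1])
       (use i hat_bounds[of a b n] in auto)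
  define W where "W = (LINT t|leb01. ?\<psi> t)"
  have "W > 0"
  proof -
    have "(LINT t|leb01. indicator {3/8<..<5/8} t) \<le> W"
      unfolding W_def
    proof (rule integral_mono[OF _ i])
      show "integrable leb01 (indicat_real {3/8<..<5/8})"
        using integrable_indicator_leb01[of "\<lambda>t. 1" "{3/8<..<5/8}"] by simp
      show "indicator {3/8<..<5/8} t \<le> ?\<psi> t" for t :: real
        using hat_bounds[of _ _ _ t] by (auto simp: indicator_def hat_def min_def)
    qed
    moreover have "(LINT t|leb01. indicat_real {3/8<..<5/8} t) = 5/8 - 3/8"
      using LINT_interval_eq_prim_diff[of "\<lambda>t. 1" "3/8" "5/8"] prim_const[of "5/8" 1] prim_const[of "3/8" 1]
      by simp
    ultimately show ?thesis by simp
  qed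
  define C where "C = (LINT t|leb01. ?\<psi> t * f t) / W"
  have "AE t in leb01. f t - C = 0"
  proof (rule AE_zero_of_hats)
    show "integrable leb01 (\<lambda>t. f t - C)" using f by simp
    fix a b :: real and n assume ab: "0 < a" "a < b" "b < 1"
    define m where "m = (LINT t|leb01. hat a b n t)"
    let ?v = "\<lambda>t. hat a b n t - (m / W) * ?\<psi> t"
    obtain \<phi> where "test_pair \<phi> ?v"
    proof (rule test_pair_of_mean_zero)
      show "continuous_on UNIV ?v"
        by (intro continuous_intros continuous_on_hat)
      show "min a (1/4) \<le> t \<and> t \<le> max b (3/4)" if "?v t \<noteq> 0" for t
        using that hat_support[of a b n t] hat_support[of "1/4" "3/4" 8 t] by force
      show "(LINT t|leb01. ?v t) = 0"
        using i \<open>W > 0\<close> by (simp add: W_def[symmetric] m_def[symmetric])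
    qed (use ab in auto)
    from zero[OF this] have "0 = (LINT t|leb01. hat a b n t * f t - (m / W) * (?\<psi> t * f t))"
      by (simp add: algebra_simps)
    also have "\<dots> = (LINT t|leb01. hat a b n t * f t) - m * C"
      using ih[OF f] by (simp add: C_def)
    also have "\<dots> = (LINT t|leb01. hat a b n t * (f t - C))"
      using ih[OF f, of a b n] i by (simp add: right_diff_distrib m_def)
    finally show "(LINT t|leb01. hat a b n t * (f t - C)) = 0" by simp
  qed
  then show ?thesis by (intro that[of C]) simp
qed

lemma has_weak_deriv_prim:
  assumes g: "integrable leb01 g"
  shows "has_weak_deriv (\<lambda>t. c + prim g t) g"
  unfolding has_weak_deriv_iff_test_pair
proof (intro allI impI)
  fix \<phi> \<phi>' assume t: "test_pair \<phi> \<phi>'"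
  then have d: "\<And>t. (\<phi> has_real_derivative \<phi>' t) (at t)" and c: "continuous_on UNIV \<phi>'"
    by (auto simp: test_pair_def)
  note p = prim_derivative[OF d c]
  have z: "\<phi> 0 = 0" "\<phi> 1 = 0"
    using t by (auto simp: test_pair_def)
  have i: "integrable leb01 \<phi>'"
    by (rule continuous_integrable_leb01[OF c])
  have i2: "integrable leb01 (\<lambda>t. \<phi>' t * prim g t)"
    using integrable_leb01_mult_bounded[OF i prim_measurable[OF g] abs_prim_le[OF g]]
    by (simp add: mult.commute)
  have "(LINT t|leb01. (c + prim g t) * \<phi>' t) = (LINT t|leb01. c * \<phi>' t + \<phi>' t * prim g t)"
    by (simp add: algebra_simps)
  also have "\<dots> = c * prim \<phi>' 1 + (LINT t|leb01. \<phi>' t * prim g t)"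
    using i i2 by (simp add: prim_1)
  also have "\<dots> = (LINT s|leb01. g s * (prim \<phi>' 1 - prim \<phi>' s))"
    using p[of 1] z by (simp add: LINT_mult_prim[OF i g])
  also have "\<dots> = (LINT s|leb01. - (g s * \<phi> s))"
    by (rule Bochner_Integration.integral_cong) (use p z in auto)
  finally show "(LINT t|leb01. (c + prim g t) * \<phi>' t) = - (LINT t|leb01. g t * \<phi> t)"
    by simp
qed

lemma has_weak_deriv_AE_cong:
  assumes "f \<in> borel_measurable leb01" "AE t in leb01. f' t = f t"
  shows "has_weak_deriv f' g \<longleftrightarrow> has_weak_deriv f g"
proof -
  have "(LINT t|leb01. f' t * \<phi>' t) = (LINT t|leb01. f t * \<phi>' t)" if "test_pair \<phi> \<phi>'" for \<phi> \<phi>'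
  proof (rule integral_cong_AE)
    have m: "\<phi>' \<in> borel_measurable leb01"
      using that by (auto simp: test_pair_def intro: borel_measurable_leb01I borel_measurable_continuous_onI)
    show "(\<lambda>t. f' t * \<phi>' t) \<in> borel_measurable leb01" "(\<lambda>t. f t * \<phi>' t) \<in> borel_measurable leb01"
      using m assms(1) borel_measurable_leb01_AE_cong[OF assms] by auto
  qed (use assms(2) in \<open>auto elim!: eventually_mono\<close>)
  then show ?thesis by (simp add: has_weak_deriv_iff_test_pair)
qed

text \<open>The primitive of the weak derivative has the same weak derivative as \<open>f\<close>, so the two differ by a
constant.\<close>

lemma has_weak_deriv_imp_AE_prim:
  assumes f: "integrable leb01 f" and g: "integrable leb01 g" and fg: "has_weak_deriv f g"
  obtains c where "AE t in leb01. f t = c + prim g t"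
proof -
  have pg: "integrable leb01 (prim g)" by (rule L2_integrable[OF prim_L2[OF g]])
  obtain C where "AE t in leb01. f t - prim g t = C"
  proof (rule weak_deriv_zero_imp_AE_const[of "\<lambda>t. f t - prim g t"])
    fix \<phi> \<phi>' assume t: "test_pair \<phi> \<phi>'"
    then have \<phi>': "\<phi>' \<in> L2" "continuous_on UNIV \<phi>'"
      by (auto simp: test_pair_def continuous_integrable_leb01)
    obtain B where B: "\<And>t. 0 < t \<Longrightarrow> t < 1 \<Longrightarrow> \<bar>\<phi>' t\<bar> \<le> B"
      using continuous_leb01_bounded[OF \<phi>'(2)] by blast
    have "integrable leb01 (\<lambda>t. h t * \<phi>' t)" if "integrable leb01 h" for h
      using integrable_leb01_mult_bounded[OF that L2_measurable[OF \<phi>'(1)] B]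
      by (simp add: mult.commute)
    then have "(LINT t|leb01. (f t - prim g t) * \<phi>' t)
        = (LINT t|leb01. f t * \<phi>' t) - (LINT t|leb01. prim g t * \<phi>' t)"
      using f pg by (simp add: left_diff_distrib)
    then show "(LINT t|leb01. (f t - prim g t) * \<phi>' t) = 0"
      using fg has_weak_deriv_prim[OF g, of 0] t by (simp add: has_weak_deriv_iff_test_pair)
  qed (use f pg in auto)
  then have "AE t in leb01. f t = C + prim g t" by (auto elim!: eventually_mono)
  then show ?thesis by (rule that)
qed


section \<open>Sobolev functions as primitives, and their traces\<close>

text \<open>The set where two continuous functions differ is open, and a nonempty open set is not a null set.\<close>

lemma continuous_AE_eq_imp_eq:
  fixes f g :: "real \<Rightarrow> real"
  assumes "continuous_on {0<..<1} f" "continuous_on {0<..<1} g" "AE t in leb01. f t = g t"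
    and "0 < t" "t < 1"
  shows "f t = g t"
proof -
  let ?S = "{0<..<1} \<inter> (\<lambda>t. f t - g t) -` (- {0})"
  have "open ?S"
    by (intro continuous_open_preimage continuous_intros assms)
  moreover have "AE x \<in> ?S in lebesgue. x \<in> {}"
    using assms(3) by (subst (asm) AE_restrict_space_iff) (auto elim!: eventually_mono)
  ultimately have "t \<notin> ?S"
    using mem_closed_if_AE_lebesgue_open[of ?S "{}" t] by blast
  then show ?thesis using assms(4,5) by auto
qed

text \<open>Both sides are continuous, so they agree everywhere in the interval. Differences of primitives are
integrals over intervals, which determine the integrand.\<close>

lemma AE_prim_unique:
  assumes g: "integrable leb01 g" "integrable leb01 g'"
    and eq: "AE t in leb01. c + prim g t = c' + prim g' t"
  shows "c = c'" "AE t in leb01. g t = g' t"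
proof -
  let ?d = "\<lambda>t. g t - g' t"
  have d: "integrable leb01 ?d" using g by simp
  have cont: "continuous_on {0<..<1} (\<lambda>t. a + prim h t)" if "integrable leb01 h" for a h
    using continuous_on_prim[OF that] by (intro continuous_intros) (auto intro: continuous_on_subset)
  have "c + prim g t = c' + prim g' t" if "0 < t" "t < 1" for t
    using continuous_AE_eq_imp_eq[OF cont[OF g(1)] cont[OF g(2)] eq that] .
  then have pd: "prim ?d t = c' - c" if "0 < t" "t < 1" for t
    using that by (simp add: prim_diff[OF g] algebra_simps)
  have ae: "AE t in leb01. ?d t = 0"
    by (rule AE_zero_of_intervals[OF d]) (simp add: LINT_interval_eq_prim_diff[OF d] pd)
  then show "AE t in leb01. g t = g' t" by simp
  have "prim ?d (1/2) = prim (\<lambda>t. 0) (1/2)"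
    by (rule prim_cong_AE) (use d ae in auto)
  then show "c = c'" using pd[of "1/2"] by (simp add: prim_const)
qed

lemma weak_deriv_spec:
  assumes "f \<in> H1"
  shows "weak_deriv f \<in> L2" "has_weak_deriv f (weak_deriv f)"
proof -
  have "\<exists>g. g \<in> L2 \<and> has_weak_deriv f g" using assms by (auto simp: H1_def)
  then have "weak_deriv f \<in> L2 \<and> has_weak_deriv f (weak_deriv f)"
    unfolding weak_deriv_def by (rule someI_ex)
  then show "weak_deriv f \<in> L2" "has_weak_deriv f (weak_deriv f)" by auto
qed

text \<open>Together with \<open>H1_E\<close> this turns every question about weak derivatives into one about primitives.\<close>

lemma AE_prim_imp_H1:
  assumes g: "g \<in> L2" and eq: "AE t in leb01. f t = c + prim g t"
  shows "f \<in> H1" "weak_deriv f \<in> L2" "AE t in leb01. weak_deriv f t = g t"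
proof -
  have gi: "integrable leb01 g" using g by (rule L2_integrable)
  have pL: "(\<lambda>t. c + prim g t) \<in> L2"
    by (intro L2_add prim_L2 gi L2_const)
  have fL: "f \<in> L2" by (rule L2_AE_cong[OF pL eq])
  have w: "has_weak_deriv f g"
    using has_weak_deriv_AE_cong[OF L2_measurable[OF pL] eq] has_weak_deriv_prim[OF gi] by simp
  show H: "f \<in> H1" using fL w g by (auto simp: H1_def)
  show dL: "weak_deriv f \<in> L2" by (rule weak_deriv_spec(1)[OF H])
  obtain c' where "AE t in leb01. f t = c' + prim (weak_deriv f) t"
    using has_weak_deriv_imp_AE_prim[OF L2_integrable[OF fL] L2_integrable[OF dL] weak_deriv_spec(2)[OF H]] .
  with eq have "AE t in leb01. c' + prim (weak_deriv f) t = c + prim g t"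
    by eventually_elim simp
  then show "AE t in leb01. weak_deriv f t = g t"
    by (rule AE_prim_unique(2)[OF L2_integrable[OF dL] gi])
qed

lemma H1_E:
  assumes "f \<in> H1"
  obtains c where "weak_deriv f \<in> L2" "AE t in leb01. f t = c + prim (weak_deriv f) t"
proof -
  have "f \<in> L2" using assms by (simp add: H1_def)
  then show ?thesis
    using has_weak_deriv_imp_AE_prim[of f "weak_deriv f"] weak_deriv_spec[OF assms] that
    by (auto simp: L2_integrable)
qed

text \<open>\<open>c + prim g\<close> is the continuous representative of \<open>f\<close>, and it is continuous up to the end points.\<close>

lemma has_trace_iff_prim:
  assumes g: "integrable leb01 g" and eq: "AE t in leb01. f t = c + prim g t" and a: "a = 0 \<or> a = 1"
  shows "has_trace f a x \<longleftrightarrow> x = c + prim g a"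
proof -
  let ?p = "\<lambda>t. c + prim g t"
  have "continuous_on UNIV ?p"
    by (intro continuous_intros continuous_on_prim g)
  then have cont: "continuous_on {0<..<1} ?p" and lim: "(?p \<longlongrightarrow> ?p a) (at a within {0<..<1})"
    by (auto intro: continuous_on_subset tendsto_within_subset simp: continuous_on_def)
  have nt: "at a within {0<..<1} \<noteq> bot"
  proof -
    have "a islimpt {0<..<1}"
      using a islimpt_greaterThanLessThan1[of 0 "1 :: real"] islimpt_greaterThanLessThan2[of 0 "1 :: real"] by auto
    then show ?thesis by (simp add: trivial_limit_within)
  qed
  show ?thesis
  proof
    assume "x = ?p a"
    then show "has_trace f a x"
      unfolding has_trace_def using cont lim eq
      by (intro exI[of _ ?p]) (auto elim!: eventually_mono)
  next
    assume "has_trace f a x"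
    then obtain h where h: "continuous_on {0<..<1} h" "AE t in leb01. h t = f t"
        "(h \<longlongrightarrow> x) (at a within {0<..<1})"
      by (auto simp: has_trace_def)
    have "AE t in leb01. h t = ?p t" using h(2) eq by eventually_elim simp
    from continuous_AE_eq_imp_eq[OF h(1) cont this]
    have "\<forall>\<^sub>F t in at a within {0<..<1}. h t = ?p t"
      by (auto simp: eventually_at_filter)
    with h(3) have "(?p \<longlongrightarrow> x) (at a within {0<..<1})"
      by (rule Lim_transform_eventually)
    then show "x = ?p a" by (rule tendsto_unique[OF nt _ lim])
  qed
qed

lemma H1_norm_nonneg: "0 \<le> H1_norm f"
  by (simp add: H1_norm_def)

lemma L2_part_le_H1_norm: "(LINT t|leb01. (f t)\<^sup>2) \<le> (H1_norm f)\<^sup>2"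
  unfolding H1_norm_def by simp

text \<open>The constant \<open>3\<close> is a convenient bound for \<open>sqrt 5\<close>: the function is bounded by \<open>2 * b\<close> and its
derivative by \<open>b\<close>.\<close>

lemma H1_norm_le:
  assumes g: "g \<in> L2" and eq: "AE t in leb01. f t = c + prim g t"
    and bg: "\<And>t. 0 < t \<Longrightarrow> t < 1 \<Longrightarrow> \<bar>g t\<bar> \<le> b" and bc: "\<bar>c\<bar> \<le> b"
  shows "H1_norm f \<le> 3 * b"
proof -
  note h = AE_prim_imp_H1[OF g eq]
  have fL: "f \<in> L2" using h(1) by (simp add: H1_def)
  have "(LINT t|leb01. \<bar>g t\<bar>) \<le> (LINT t|leb01. b)"
    by (rule integral_mono) (use L2_integrable[OF g] bg in auto)
  then have pb: "\<bar>prim g t\<bar> \<le> b" for t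
    using abs_prim_le[OF L2_integrable[OF g], of t] by simp
  have "(LINT t|leb01. (f t)\<^sup>2) \<le> (LINT t|leb01. (2 * b)\<^sup>2)"
  proof (rule integral_mono_AE)
    show "AE t in leb01. (f t)\<^sup>2 \<le> (2 * b)\<^sup>2"
      using eq
    proof eventually_elim
      case (elim t)
      have "\<bar>f t\<bar> \<le> 2 * b" using elim pb[of t] bc by linarith
      then have "\<bar>f t\<bar> \<le> \<bar>2 * b\<bar>" by linarith
      then show ?case by (simp only: abs_le_square_iff)
    qed
  qed (use L2_square_integrable[OF fL] in auto)
  moreover have "(LINT t|leb01. (weak_deriv f t)\<^sup>2) \<le> (LINT t|leb01. b\<^sup>2)"
  proof (rule integral_mono_AE)
    show "AE t in leb01. (weak_deriv f t)\<^sup>2 \<le> b\<^sup>2"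
      using h(3) AE_space
    proof eventually_elim
      case (elim t)
      then have "\<bar>weak_deriv f t\<bar> \<le> \<bar>b\<bar>" using bg[of t] by simp
      then show ?case by (simp add: abs_le_square_iff[symmetric])
    qed
  qed (use L2_square_integrable[OF h(2)] in auto)
  ultimately have "(LINT t|leb01. (f t)\<^sup>2) + (LINT t|leb01. (weak_deriv f t)\<^sup>2) \<le> (2 * b)\<^sup>2 + b\<^sup>2"
    by simp
  also have "\<dots> \<le> (3 * b)\<^sup>2" by (simp add: power2_eq_square)
  finally show ?thesis
    unfolding H1_norm_def using bc by (intro real_le_lsqrt) auto
qed

text \<open>Convergence in \<open>H\<^sup>1\<close> implies convergence in \<open>L\<^sup>2\<close>, where limits are unique. The triangle
inequality is replaced by \<open>(x + y)\<^sup>2 \<le> 2 * x\<^sup>2 + 2 * y\<^sup>2\<close>.\<close>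

lemma H1_limit_AE_unique:
  assumes p: "p \<in> L2" and u: "u \<in> L2" and w: "\<forall>\<^sub>F n in sequentially. w n \<in> L2"
    and lim: "(\<lambda>n. H1_norm (\<lambda>t. w n t - p t)) \<longlonglongrightarrow> 0" "(\<lambda>n. H1_norm (\<lambda>t. w n t - u t)) \<longlonglongrightarrow> 0"
  shows "AE t in leb01. p t = u t"
proof -
  let ?b = "\<lambda>n. 2 * (H1_norm (\<lambda>t. w n t - p t))\<^sup>2 + 2 * (H1_norm (\<lambda>t. w n t - u t))\<^sup>2"
  have "?b \<longlonglongrightarrow> 2 * 0\<^sup>2 + 2 * 0\<^sup>2"
    by (intro tendsto_intros lim)
  then have "?b \<longlonglongrightarrow> 0" by simp
  moreover have "\<forall>\<^sub>F n in sequentially. (LINT t|leb01. (p t - u t)\<^sup>2) \<le> ?b n"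
    using w
  proof eventually_elim
    case (elim n)
    note i = L2_square_integrable[OF L2_diff[OF elim p]] L2_square_integrable[OF L2_diff[OF elim u]]
    have "(LINT t|leb01. (p t - u t)\<^sup>2) \<le> (LINT t|leb01. 2 * (w n t - p t)\<^sup>2 + 2 * (w n t - u t)\<^sup>2)"
    proof (rule integral_mono)
      fix t
      show "(p t - u t)\<^sup>2 \<le> 2 * (w n t - p t)\<^sup>2 + 2 * (w n t - u t)\<^sup>2"
        using zero_le_power2[of "(w n t - p t) + (w n t - u t)"]
        by (simp add: power2_eq_square algebra_simps)
    qed (use i L2_square_integrable[OF L2_diff[OF p u]] in auto)
    also have "\<dots> = 2 * (LINT t|leb01. (w n t - p t)\<^sup>2) + 2 * (LINT t|leb01. (w n t - u t)\<^sup>2)"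
      using i by simp
    also have "\<dots> \<le> ?b n"
      by (intro add_mono mult_left_mono L2_part_le_H1_norm) auto
    finally show ?case .
  qed
  ultimately have "(LINT t|leb01. (p t - u t)\<^sup>2) \<le> 0"
    by (intro tendsto_lowerbound[of ?b]) auto
  then have "(LINT t|leb01. (p t - u t)\<^sup>2) = 0"
    by (intro antisym) auto
  then have "AE t in leb01. (p t - u t)\<^sup>2 = 0"
    using L2_square_integrable[OF L2_diff[OF p u]] by (subst (asm) integral_nonneg_eq_0_iff_AE) auto
  then show ?thesis by simp
qed


section \<open>The solution on a single edge\<close>

text \<open>The derivative of the solution of \<open>- u'' = g\<close>, \<open>u(0) = c\<close>, \<open>u(1) = 0\<close>. The initial slope is
\<open>prim (prim g) 1 - c\<close>, because the integral of the slope over the unit interval has to be \<open>- c\<close>.\<close>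

definition slope :: "(real \<Rightarrow> real) \<Rightarrow> real \<Rightarrow> real \<Rightarrow> real" where
  "slope g c t = prim (prim g) 1 - prim g t - c"

definition profile :: "(real \<Rightarrow> real) \<Rightarrow> real \<Rightarrow> real \<Rightarrow> real" where
  "profile g c t = c + prim (slope g c) t"

lemma slope_L2: "integrable leb01 g \<Longrightarrow> slope g c \<in> L2"
  unfolding slope_def by (intro L2_diff prim_L2 L2_const)

lemma profile_L2: "integrable leb01 g \<Longrightarrow> profile g c \<in> L2"
  unfolding profile_def by (intro L2_add L2_const prim_L2 L2_integrable[OF slope_L2])

lemma abs_slope_le:
  "integrable leb01 g \<Longrightarrow> \<bar>slope g c t\<bar> \<le> 2 * (LINT s|leb01. \<bar>g s\<bar>) + \<bar>c\<bar>"
  using abs_prim_le[of g t] abs_prim_prim_le[of g 1] unfolding slope_def by linarith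

text \<open>The estimate behind every limit below: the profile depends continuously in \<open>H\<^sup>1\<close> on the forcing
in \<open>L\<^sup>1\<close> and on the central value. The \<open>L\<^sup>1\<close> norm is enough since the forcing enters only
through its primitive.\<close>

lemma H1_norm_profile_le:
  assumes "integrable leb01 g" "AE t in leb01. f t = profile g c t"
  shows "H1_norm f \<le> 6 * ((LINT s|leb01. \<bar>g s\<bar>) + \<bar>c\<bar>)"
proof -
  let ?L = "LINT s|leb01. \<bar>g s\<bar>"
  have L: "?L \<ge> 0" by simp
  have "H1_norm f \<le> 3 * (2 * ?L + \<bar>c\<bar>)"
    by (rule H1_norm_le[OF slope_L2[OF assms(1), of c], of _ c])
       (use assms abs_slope_le L in \<open>auto simp: profile_def\<close>)
  then show ?thesis using L by simp
qed

lemma H1_norm_profile_tendsto_0: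
  assumes g: "\<And>n::nat. integrable leb01 (g n)"
    and eq: "\<forall>\<^sub>F n in sequentially. AE t in leb01. f n t = profile (g n) (c n) t"
    and lim: "(\<lambda>n. LINT t|leb01. \<bar>g n t\<bar>) \<longlonglongrightarrow> 0" "c \<longlonglongrightarrow> 0"
  shows "(\<lambda>n. H1_norm (f n)) \<longlonglongrightarrow> 0"
proof (rule tendsto_sandwich[where f = "\<lambda>_. 0"])
  show "(\<lambda>n. 6 * ((LINT t|leb01. \<bar>g n t\<bar>) + \<bar>c n\<bar>)) \<longlonglongrightarrow> 0"
    using tendsto_mult_right_zero[OF tendsto_add_zero[OF lim(1) tendsto_rabs_zero[OF lim(2)]], of 6] .
  show "\<forall>\<^sub>F n in sequentially. H1_norm (f n) \<le> 6 * ((LINT t|leb01. \<bar>g n t\<bar>) + \<bar>c n\<bar>)"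
    using eq by eventually_elim (rule H1_norm_profile_le[OF g])
qed (auto simp: H1_norm_nonneg)

lemma slope_diff:
  assumes "integrable leb01 f" "integrable leb01 g"
  shows "slope (\<lambda>t. f t - g t) (c - d) t = slope f c t - slope g d t"
proof -
  have "prim (\<lambda>t. f t - g t) = (\<lambda>t. prim f t - prim g t)"
    using assms by (simp add: prim_diff fun_eq_iff)
  then show ?thesis
    using assms by (simp add: slope_def prim_diff integrable_prim)
qed

lemma slope_sum:
  assumes "\<And>j. j \<in> J \<Longrightarrow> integrable leb01 (f j)"
  shows "slope (\<lambda>t. \<Sum>j\<in>J. f j t) (\<Sum>j\<in>J. c j) t = (\<Sum>j\<in>J. slope (f j) (c j) t)"
proof -
  have "prim (\<lambda>t. \<Sum>j\<in>J. f j t) = (\<lambda>t. \<Sum>j\<in>J. prim (f j) t)"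
    using assms by (simp add: prim_sum fun_eq_iff)
  then show ?thesis
    using assms by (simp add: slope_def prim_sum integrable_prim sum_subtractf)
qed

lemma slope_cmult: "slope (\<lambda>t. a * f t) (a * c) t = a * slope f c t"
proof -
  have "prim (\<lambda>t. a * f t) = (\<lambda>t. a * prim f t)"
    by (simp add: prim_cmult fun_eq_iff)
  then show ?thesis
    by (simp add: slope_def prim_cmult right_diff_distrib)
qed

lemma profile_diff:
  assumes "integrable leb01 f" "integrable leb01 g"
  shows "profile (\<lambda>t. f t - g t) (c - d) t = profile f c t - profile g d t"
proof -
  have "slope (\<lambda>t. f t - g t) (c - d) = (\<lambda>t. slope f c t - slope g d t)"
    using assms by (simp add: slope_diff fun_eq_iff)
  then show ?thesis
    using assms by (simp add: profile_def prim_diff L2_integrable slope_L2)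
qed

lemma profile_sum:
  assumes "\<And>j. j \<in> J \<Longrightarrow> integrable leb01 (f j)"
  shows "profile (\<lambda>t. \<Sum>j\<in>J. f j t) (\<Sum>j\<in>J. c j) t = (\<Sum>j\<in>J. profile (f j) (c j) t)"
proof -
  have "slope (\<lambda>t. \<Sum>j\<in>J. f j t) (\<Sum>j\<in>J. c j) = (\<lambda>t. \<Sum>j\<in>J. slope (f j) (c j) t)"
    using assms by (simp add: slope_sum fun_eq_iff)
  then show ?thesis
    using assms by (simp add: profile_def prim_sum L2_integrable slope_L2 sum.distrib)
qed

lemma profile_cmult: "profile (\<lambda>t. a * f t) (a * c) t = a * profile f c t"
  by (simp add: profile_def slope_cmult[abs_def] prim_cmult distrib_left)

text \<open>Averaging commutes with solving as long as the conductivity \<open>k\<close> and the central value \<open>c\<close> are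
common to all edges.\<close>

lemma profile_average:
  assumes J: "finite J" "J \<noteq> {}" and f: "\<And>j. j \<in> J \<Longrightarrow> integrable leb01 (f j)"
  shows "(\<Sum>j\<in>J. profile (\<lambda>t. f j t / k) c t) / real (card J)
    = profile (\<lambda>t. ((\<Sum>j\<in>J. f j t) / real (card J)) / k) c t"
proof -
  let ?m = "real (card J)"
  have m: "?m > 0" using J by (simp add: card_gt_0_iff)
  have "(\<Sum>j\<in>J. profile (\<lambda>t. f j t / k) c t) / ?m
      = (1 / ?m) * profile (\<lambda>t. \<Sum>j\<in>J. f j t / k) (\<Sum>j\<in>J. c) t"
    by (subst profile_sum) (use f in auto)
  also have "\<dots> = profile (\<lambda>t. (1 / ?m) * (\<Sum>j\<in>J. f j t / k)) ((1 / ?m) * (\<Sum>j\<in>J. c)) t"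
    by (rule profile_cmult[symmetric])
  also have "(\<lambda>t. (1 / ?m) * (\<Sum>j\<in>J. f j t / k)) = (\<lambda>t. ((\<Sum>j\<in>J. f j t) / ?m) / k)"
    by (simp add: sum_divide_distrib[symmetric] mult.commute)
  also have "(1 / ?m) * (\<Sum>j\<in>J. c) = c" using m by simp
  finally show ?thesis .
qed

lemma prim_slope_1: "integrable leb01 g \<Longrightarrow> prim (slope g c) 1 = - c"
  unfolding slope_def
  by (simp add: prim_diff integrable_prim prim_const Bochner_Integration.integrable_diff)

text \<open>The weak formulation on one edge. The boundary term is the value of the test function at the center
times the slope there.\<close>

lemma LINT_slope_mult:
  assumes f: "f \<in> L2" and g: "g \<in> L2" and q: "AE t in leb01. q t = c + prim g t"
    and q1: "c + prim g 1 = 0"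
  shows "(LINT t|leb01. slope f d t * g t)
    = (LINT t|leb01. f t * q t) - (prim (prim f) 1 - d) * c"
proof -
  note fi = L2_integrable[OF f] and gi = L2_integrable[OF g]
  have qL: "q \<in> L2"
    by (rule L2_AE_cong[OF _ q]) (intro L2_add L2_const prim_L2 gi)
  have i: "integrable leb01 (\<lambda>t. g t * prim f t)"
    by (rule L2_mult_integrable[OF g prim_L2[OF fi]])
  have "(LINT t|leb01. slope f d t * g t)
      = (LINT t|leb01. (prim (prim f) 1 - d) * g t - g t * prim f t)"
    by (simp add: slope_def algebra_simps)
  also have "\<dots> = (prim (prim f) 1 - d) * prim g 1 - (LINT t|leb01. g t * prim f t)"
    using gi i by (simp add: prim_1)
  also have "(LINT t|leb01. g t * prim f t) = (LINT t|leb01. f t * (prim g 1 - prim g t))"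
    by (rule LINT_mult_prim[OF gi fi])
  also have "\<dots> = (LINT t|leb01. - (f t * q t))"
  proof (rule integral_cong_AE)
    show "AE t in leb01. f t * (prim g 1 - prim g t) = - (f t * q t)"
      using q
    proof eventually_elim
      case (elim t)
      then have "prim g 1 - prim g t = - q t" using q1 by simp
      then show ?case by simp
    qed
  qed (use L2_measurable[OF f] L2_measurable[OF qL] prim_measurable[OF gi] in auto)
  also have "prim g 1 = - c" using q1 by simp
  finally show ?thesis by simp
qed


section \<open>Weighted problems on finite stars\<close>

text \<open>All edges of the limit graph and of the upscaled graph are of this kind.\<close>

definition spoke :: "(real^2) set \<Rightarrow> bool" where
  "spoke e \<longleftrightarrow> (\<exists>x. norm x = 1 \<and> e = closed_segment 0 x)"

lemma outer_pt_closed_segment: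
  assumes "norm x = 1"
  shows "outer_pt (closed_segment 0 x) = x"
  unfolding outer_pt_def
proof (rule the_equality)
  show "x \<in> closed_segment 0 x \<and> norm x = 1" using assms by simp
  fix y assume "y \<in> closed_segment 0 x \<and> norm y = 1"
  then obtain u where "y = u *\<^sub>R x" "0 \<le> u" "norm y = 1" unfolding in_segment by force
  then show "y = x" using assms by simp
qed

lemma spoke_outer_pt:
  assumes "spoke e"
  shows "norm (outer_pt e) = 1" "e = closed_segment 0 (outer_pt e)"
  using assms by (auto simp: spoke_def outer_pt_closed_segment)

lemma spoke_star_edge: "v 0 = 0 \<Longrightarrow> norm (v i) = 1 \<Longrightarrow> spoke (star_edge v i)"
  by (auto simp: spoke_def star_edge_def)

lemma outer_pt_star_edge: "v 0 = 0 \<Longrightarrow> norm (v i) = 1 \<Longrightarrow> outer_pt (star_edge v i) = v i"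
  by (simp add: star_edge_def outer_pt_closed_segment)

lemma on_edge_diff: "on_edge (\<lambda>x. p x - q x) e = (\<lambda>t. on_edge p e t - on_edge q e t)"
  by (simp add: on_edge_def fun_eq_iff)

text \<open>A point \<open>x\<close> other than the origin lies on the spoke in direction \<open>x\<close>, at distance \<open>norm x\<close> from
the center, so a family of functions on the spokes defines a function on the plane.\<close>

definition glue :: "((real^2) set \<Rightarrow> real \<Rightarrow> real) \<Rightarrow> real^2 \<Rightarrow> real" where
  "glue u x = u (closed_segment 0 (x /\<^sub>R norm x)) (norm x)"

lemma on_edge_glue:
  assumes "spoke e" "0 < t"
  shows "on_edge (glue u) e t = u e t"
  using spoke_outer_pt[OF assms(1)] assms(2) by (simp add: on_edge_def glue_def)

lemma ex_on_edges:
  assumes E: "inj_on E J" "\<And>j. j \<in> J \<Longrightarrow> spoke (E j)"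
  shows "\<exists>u. \<forall>j\<in>J. AE t in leb01. on_edge u (E j) t = w j t"
proof (intro exI ballI AE_leb01I)
  fix j and t :: real assume "j \<in> J" "0 < t"
  then show "on_edge (glue (\<lambda>e. w (the_inv_into J E e))) (E j) t = w j t"
    using E by (simp add: on_edge_glue the_inv_into_f_f)
qed

lemma star_H10_I:
  assumes "\<And>e. e \<in> Es \<Longrightarrow> g e \<in> L2"
    and "\<And>e. e \<in> Es \<Longrightarrow> AE t in leb01. on_edge p e t = c + prim (g e) t"
    and "\<And>e. e \<in> Es \<Longrightarrow> c + prim (g e) 1 = 0"
  shows "p \<in> star_H10 Es"
proof -
  have "on_edge p e \<in> H1" "has_trace (on_edge p e) 0 c" "has_trace (on_edge p e) 1 0" if "e \<in> Es" for e
  proof -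
    show "on_edge p e \<in> H1"
      by (rule AE_prim_imp_H1(1)) (use assms that in auto)
    show "has_trace (on_edge p e) 0 c" "has_trace (on_edge p e) 1 0"
      using has_trace_iff_prim[OF L2_integrable[OF assms(1)[OF that]] assms(2)[OF that]] assms(3)[OF that]
      by auto
  qed
  then show ?thesis by (auto simp: star_H10_def star_H1_def)
qed

text \<open>The values at the two ends of an edge are read off from the representation as a primitive, the
first one being the common central value.\<close>

lemma star_H10_D:
  assumes "q \<in> star_H10 Es" "e \<in> Es"
  shows "weak_deriv (on_edge q e) \<in> L2"
    and "AE t in leb01. on_edge q e t = center_value Es q + prim (weak_deriv (on_edge q e)) t"
    and "center_value Es q + prim (weak_deriv (on_edge q e)) 1 = 0"
proof -
  let ?g = "weak_deriv (on_edge q e)"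
  have "on_edge q e \<in> H1" and t1: "has_trace (on_edge q e) 1 0"
    using assms by (auto simp: star_H10_def star_H1_def)
  then obtain c where g: "?g \<in> L2" and ae: "AE t in leb01. on_edge q e t = c + prim ?g t"
    by (auto elim: H1_E)
  note tr = has_trace_iff_prim[OF L2_integrable[OF g] ae]
  have "\<exists>c'. \<forall>e\<in>Es. has_trace (on_edge q e) 0 c'"
    using assms by (auto simp: star_H10_def star_H1_def)
  moreover have "c' = c" if "\<forall>e\<in>Es. has_trace (on_edge q e) 0 c'" for c'
    using that assms(2) tr[of 0 c'] by auto
  ultimately have "center_value Es q = c"
    unfolding center_value_def by (intro the_equality) auto
  with g ae tr[of 1 0] t1
  show "?g \<in> L2" "AE t in leb01. on_edge q e t = center_value Es q + prim ?g t"
    "center_value Es q + prim ?g 1 = 0"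
    by auto
qed

text \<open>The edges are indexed and carry arbitrary coefficients, so that the definition covers the problem on
\<open>G\<^sub>n\<close>, with coefficient \<open>K(e)\<close> on \<open>e\<close>, and the homogenized one, with coefficient
\<open>s\<^sub>i K\<^sub>i\<close> and forcing \<open>s\<^sub>i F\<^sub>i\<close> on \<open>\<sigma>\<^sub>i\<close>.\<close>

definition star_problem ::
  "'j set \<Rightarrow> ('j \<Rightarrow> (real^2) set) \<Rightarrow> ('j \<Rightarrow> real) \<Rightarrow> ('j \<Rightarrow> real \<Rightarrow> real) \<Rightarrow> real \<Rightarrow> (real^2 \<Rightarrow> real) \<Rightarrow> bool"
  where "star_problem J E a f h p \<longleftrightarrow>
     p \<in> star_H10 (E ` J) \<and>
     (\<forall>q \<in> star_H10 (E ` J).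
        (\<Sum>j\<in>J. a j * (LINT t|leb01. weak_deriv (on_edge p (E j)) t * weak_deriv (on_edge q (E j)) t))
        = (\<Sum>j\<in>J. LINT t|leb01. f j t * on_edge q (E j) t) + h * center_value (E ` J) q)"

text \<open>The central value for which the fluxes \<open>a j * slope (f j / a j) c 0 = prim (prim (f j)) 1 - a j * c\<close>
leaving the center add up to \<open>- h\<close>.\<close>

definition center_height :: "'j set \<Rightarrow> ('j \<Rightarrow> real) \<Rightarrow> ('j \<Rightarrow> real \<Rightarrow> real) \<Rightarrow> real \<Rightarrow> real" where
  "center_height J a f h = ((\<Sum>j\<in>J. prim (prim (f j)) 1) + h) / (\<Sum>j\<in>J. a j)"

text \<open>Summing the weak formulation over the edges leaves the boundary terms at the center, and the
central value has been chosen such that they add up to the source term \<open>h\<close>.\<close>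

lemma profile_imp_star_problem:
  assumes J: "finite J" "J \<noteq> {}"
    and a: "\<And>j. j \<in> J \<Longrightarrow> a j > 0" and f: "\<And>j. j \<in> J \<Longrightarrow> f j \<in> L2"
    and c: "c = center_height J a f h"
    and p: "\<And>j. j \<in> J \<Longrightarrow> AE t in leb01. on_edge p (E j) t = profile (\<lambda>t. f j t / a j) c t"
  shows "star_problem J E a f h p"
  unfolding star_problem_def
proof (intro conjI ballI)
  let ?f = "\<lambda>j t. f j t / a j"
  have fL: "?f j \<in> L2" if "j \<in> J" for j
    by (rule L2_divide[OF f[OF that]])
  have sL: "slope (?f j) c \<in> L2" if "j \<in> J" for j
    by (rule slope_L2[OF L2_integrable[OF fL[OF that]]])
  have p': "AE t in leb01. on_edge p (E j) t = c + prim (slope (?f j) c) t" if "j \<in> J" for j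
    using p[OF that] by (simp add: profile_def)
  show "p \<in> star_H10 (E ` J)"
  proof (rule star_H10_I[where g = "\<lambda>e. weak_deriv (on_edge p e)" and c = c])
    fix e assume "e \<in> E ` J"
    then obtain j where j: "j \<in> J" "e = E j" by auto
    note w = AE_prim_imp_H1[OF sL[OF j(1)] p'[OF j(1)]]
    have eq: "prim (weak_deriv (on_edge p e)) = prim (slope (?f j) c)"
      using w(2,3) L2_measurable[OF sL[OF j(1)]] j by (intro ext prim_cong_AE) (auto intro: L2_measurable)
    show "weak_deriv (on_edge p e) \<in> L2" using w j by simp
    show "AE t in leb01. on_edge p e t = c + prim (weak_deriv (on_edge p e)) t"
      using p'[OF j(1)] j eq by simp
    show "c + prim (weak_deriv (on_edge p e)) 1 = 0"
      using eq prim_slope_1[OF L2_integrable[OF fL[OF j(1)]]] by simp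
  qed
  fix q assume q: "q \<in> star_H10 (E ` J)"
  let ?x = "center_value (E ` J) q"
  have "a j * (LINT t|leb01. weak_deriv (on_edge p (E j)) t * weak_deriv (on_edge q (E j)) t)
      = (LINT t|leb01. f j t * on_edge q (E j) t) - (prim (prim (f j)) 1 - a j * c) * ?x"
    if j: "j \<in> J" for j
  proof -
    note w = AE_prim_imp_H1[OF sL[OF j] p'[OF j]]
    note D = star_H10_D[OF q imageI[OF j]]
    have "(LINT t|leb01. weak_deriv (on_edge p (E j)) t * weak_deriv (on_edge q (E j)) t)
        = (LINT t|leb01. slope (?f j) c t * weak_deriv (on_edge q (E j)) t)"
      using w(3) L2_measurable[OF sL[OF j]] L2_measurable[OF w(2)] L2_measurable[OF D(1)]
      by (intro integral_cong_AE) (auto elim!: eventually_mono)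
    also have "\<dots> = (LINT t|leb01. ?f j t * on_edge q (E j) t) - (prim (prim (?f j)) 1 - c) * ?x"
      by (rule LINT_slope_mult[OF fL[OF j] D])
    also have "prim (prim (?f j)) 1 = prim (prim (f j)) 1 / a j"
    proof -
      have "prim (?f j) = (\<lambda>t. 1 / a j * prim (f j) t)"
        using prim_cmult[of "1 / a j" "f j"] by (simp add: fun_eq_iff)
      then show ?thesis
        using prim_cmult[of "1 / a j" "prim (f j)" 1] by simp
    qed
    also have "(LINT t|leb01. ?f j t * on_edge q (E j) t) = (LINT t|leb01. f j t * on_edge q (E j) t) / a j"
      by simp
    finally show ?thesis using a[OF j] by (simp add: field_simps)
  qed
  then have "(\<Sum>j\<in>J. a j * (LINT t|leb01. weak_deriv (on_edge p (E j)) t * weak_deriv (on_edge q (E j)) t))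
      = (\<Sum>j\<in>J. LINT t|leb01. f j t * on_edge q (E j) t)
        - ((\<Sum>j\<in>J. prim (prim (f j)) 1) - (\<Sum>j\<in>J. a j) * c) * ?x"
    by (simp add: sum_subtractf sum_distrib_right left_diff_distrib)
  moreover have "(\<Sum>j\<in>J. a j) > 0" using J a by (intro sum_pos) auto
  then have "(\<Sum>j\<in>J. a j) * c = (\<Sum>j\<in>J. prim (prim (f j)) 1) + h"
    by (simp add: c center_height_def)
  ultimately show "(\<Sum>j\<in>J. a j * (LINT t|leb01. weak_deriv (on_edge p (E j)) t * weak_deriv (on_edge q (E j)) t))
      = (\<Sum>j\<in>J. LINT t|leb01. f j t * on_edge q (E j) t) + h * ?x"
    by simp
qed

text \<open>Testing with the difference of two solutions shows that their derivatives agree; both vanish at the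
outer ends, so they agree.\<close>

lemma star_problem_unique:
  assumes J: "finite J" and a: "\<And>j. j \<in> J \<Longrightarrow> a j > 0"
    and p: "star_problem J E a f h p" and u: "star_problem J E a f h u" and j: "j \<in> J"
  shows "AE t in leb01. on_edge p (E j) t = on_edge u (E j) t"
proof -
  let ?w = "\<lambda>x. p x - u x"
  let ?dp = "\<lambda>j. weak_deriv (on_edge p (E j))" and ?du = "\<lambda>j. weak_deriv (on_edge u (E j))"
  let ?dw = "\<lambda>j. weak_deriv (on_edge ?w (E j))"
  have pH: "p \<in> star_H10 (E ` J)" and uH: "u \<in> star_H10 (E ` J)"
    using p u by (auto simp: star_problem_def)
  note P = star_H10_D[OF pH imageI] and U = star_H10_D[OF uH imageI]
  have dL: "(\<lambda>t. ?dp i t - ?du i t) \<in> L2" if "i \<in> J" for i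
    by (rule L2_diff[OF P(1)[OF that] U(1)[OF that]])
  let ?c = "center_value (E ` J) p - center_value (E ` J) u"
  have ae: "AE t in leb01. on_edge ?w (E i) t = ?c + prim (\<lambda>t. ?dp i t - ?du i t) t" if "i \<in> J" for i
    using P(2)[OF that] U(2)[OF that]
    by eventually_elim (simp add: on_edge_diff prim_diff L2_integrable P(1) U(1) that)
  have wH: "?w \<in> star_H10 (E ` J)"
  proof (rule star_H10_I[where g = "\<lambda>e t. weak_deriv (on_edge p e) t - weak_deriv (on_edge u e) t" and c = ?c])
    fix e assume "e \<in> E ` J"
    then obtain i where i: "i \<in> J" "e = E i" by auto
    show "?c + prim (\<lambda>t. weak_deriv (on_edge p e) t - weak_deriv (on_edge u e) t) 1 = 0"
      using P(3)[OF i(1)] U(3)[OF i(1)] by (simp add: i(2) prim_diff L2_integrable P(1) U(1) i(1))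
  qed (use dL ae in auto)
  have dw: "AE t in leb01. ?dw i t = ?dp i t - ?du i t" and dwL: "?dw i \<in> L2" if "i \<in> J" for i
    using AE_prim_imp_H1[OF dL[OF that] ae[OF that]] by auto
  have "(\<Sum>i\<in>J. a i * (LINT t|leb01. ?dp i t * ?dw i t)) = (\<Sum>i\<in>J. a i * (LINT t|leb01. ?du i t * ?dw i t))"
    using p u wH by (simp add: star_problem_def)
  then have "(\<Sum>i\<in>J. a i * ((LINT t|leb01. ?dp i t * ?dw i t) - (LINT t|leb01. ?du i t * ?dw i t))) = 0"
    by (simp add: right_diff_distrib sum_subtractf)
  moreover have "(LINT t|leb01. ?dp i t * ?dw i t) - (LINT t|leb01. ?du i t * ?dw i t)
      = (LINT t|leb01. (?dp i t - ?du i t)\<^sup>2)" if i: "i \<in> J" for i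
  proof -
    have "(LINT t|leb01. ?dp i t * ?dw i t) - (LINT t|leb01. ?du i t * ?dw i t)
        = (LINT t|leb01. ?dp i t * ?dw i t - ?du i t * ?dw i t)"
      by (rule Bochner_Integration.integral_diff[symmetric])
         (intro L2_mult_integrable P(1) U(1) dwL i)+
    also have "\<dots> = (LINT t|leb01. (?dp i t - ?du i t)\<^sup>2)"
    proof (rule integral_cong_AE)
      show "AE t in leb01. ?dp i t * ?dw i t - ?du i t * ?dw i t = (?dp i t - ?du i t)\<^sup>2"
        using dw[OF i] by eventually_elim (simp add: power2_eq_square left_diff_distrib)
    qed (use L2_measurable[OF P(1)[OF i]] L2_measurable[OF U(1)[OF i]] L2_measurable[OF dwL[OF i]] in auto)
    finally show ?thesis .
  qed
  ultimately have "(\<Sum>i\<in>J. a i * (LINT t|leb01. (?dp i t - ?du i t)\<^sup>2)) = 0"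
    by simp
  then have "\<forall>i\<in>J. a i * (LINT t|leb01. (?dp i t - ?du i t)\<^sup>2) = 0"
    by (subst (asm) sum_nonneg_eq_0_iff[OF J]) (use a in \<open>auto intro!: mult_nonneg_nonneg intro: less_imp_le\<close>)
  then have "a j * (LINT t|leb01. (?dp j t - ?du j t)\<^sup>2) = 0"
    using j by blast
  then have "(LINT t|leb01. (?dp j t - ?du j t)\<^sup>2) = 0"
    using a[OF j] by simp
  then have "AE t in leb01. (?dp j t - ?du j t)\<^sup>2 = 0"
    using L2_square_integrable[OF dL[OF j]] by (subst (asm) integral_nonneg_eq_0_iff_AE) auto
  then have "AE t in leb01. ?dp j t = ?du j t" by simp
  then have eq: "prim (?dp j) s = prim (?du j) s" for s
    by (intro prim_cong_AE L2_measurable P(1) U(1) j)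
  with P(3)[OF j] U(3)[OF j] have ceq: "center_value (E ` J) p = center_value (E ` J) u"
    by (simp add: eq)
  from P(2)[OF j] U(2)[OF j] show ?thesis
    by eventually_elim (simp add: eq ceq)
qed

lemma star_problem_iff_profile:
  assumes J: "finite J" "J \<noteq> {}" and E: "inj_on E J" "\<And>j. j \<in> J \<Longrightarrow> spoke (E j)"
    and a: "\<And>j. j \<in> J \<Longrightarrow> a j > 0" and f: "\<And>j. j \<in> J \<Longrightarrow> f j \<in> L2"
  shows "star_problem J E a f h p \<longleftrightarrow>
    (\<forall>j\<in>J. AE t in leb01. on_edge p (E j) t = profile (\<lambda>t. f j t / a j) (center_height J a f h) t)"
proof
  let ?P = "\<lambda>j. profile (\<lambda>t. f j t / a j) (center_height J a f h)"
  from ex_on_edges[OF E, where w = ?P]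
  obtain u where "\<forall>j\<in>J. AE t in leb01. on_edge u (E j) t = ?P j t" ..
  then have u: "AE t in leb01. on_edge u (E j) t = ?P j t" if "j \<in> J" for j
    using that ..
  have "star_problem J E a f h u"
    by (rule profile_imp_star_problem[OF J a f refl u])
  then have unique: "AE t in leb01. on_edge p (E j) t = on_edge u (E j) t"
    if "star_problem J E a f h p" "j \<in> J" for j
    using star_problem_unique[OF J(1) a that(1) _ that(2)] by blast
  show "\<forall>j\<in>J. AE t in leb01. on_edge p (E j) t = ?P j t" if "star_problem J E a f h p"
  proof
    fix j assume j: "j \<in> J"
    from unique[OF that j] u[OF j] show "AE t in leb01. on_edge p (E j) t = ?P j t"
      by eventually_elim simp
  qed
qed (rule profile_imp_star_problem[OF J a f refl], auto)

lemma stage_solution_iff_profile: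
  assumes Es: "finite Es" "Es \<noteq> {}" "\<And>e. e \<in> Es \<Longrightarrow> spoke e"
    and K: "\<And>e t. e \<in> Es \<Longrightarrow> 0 < t \<Longrightarrow> t < 1 \<Longrightarrow> on_edge K e t = Ke e"
    and Ke: "\<And>e. e \<in> Es \<Longrightarrow> Ke e > 0" and F: "\<And>e. e \<in> Es \<Longrightarrow> on_edge F e \<in> L2"
  shows "stage_solution Es K F h p \<longleftrightarrow>
    (\<forall>e\<in>Es. AE t in leb01. on_edge p e t
       = profile (\<lambda>t. on_edge F e t / Ke e) (center_height Es Ke (on_edge F) h) t)"
proof -
  have "(LINT t|leb01. on_edge K e t * weak_deriv (on_edge p e) t * weak_deriv (on_edge q e) t)
      = Ke e * (LINT t|leb01. weak_deriv (on_edge p e) t * weak_deriv (on_edge q e) t)"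
    if "e \<in> Es" for e q
    unfolding integral_mult_right_zero[symmetric] mult.assoc
    by (rule Bochner_Integration.integral_cong) (use K that in auto)
  then have "stage_solution Es K F h p \<longleftrightarrow> star_problem Es (\<lambda>e. e) Ke (on_edge F) h p"
    by (simp add: stage_solution_def star_problem_def cong: sum.cong)
  also have "\<dots> \<longleftrightarrow> (\<forall>e\<in>Es. AE t in leb01. on_edge p e t
       = profile (\<lambda>t. on_edge F e t / Ke e) (center_height Es Ke (on_edge F) h) t)"
    by (rule star_problem_iff_profile) (use assms in auto)
  finally show ?thesis .
qed


section \<open>The homogenized problem\<close>

lemma upscaled_edges_eq: "upscaled_edges N = upscaled_edge N ` {1..N}"
  by (simp add: upscaled_edges_def upscaled_edge_def star_edges_def)

lemma norm_circle_pt [simp]: "norm (circle_pt x) = 1"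
  by (simp add: circle_pt_def norm_vec_def L2_set_def sum_2)

lemma circle_pt_inj:
  assumes "circle_pt x = circle_pt y" "\<bar>x - y\<bar> < 2 * pi"
  shows "x = y"
proof -
  have "cos x = cos y" "sin x = sin y"
    using assms(1) by (auto simp: circle_pt_def vec_eq_iff forall_2)
  then obtain n :: int where n: "x = y + 2 * pi * of_int n"
    using sin_cos_eq_iff[of x y] by (auto simp: mult.commute mult.left_commute)
  then have "2 * pi * \<bar>real_of_int n\<bar> < 2 * pi * 1" using assms(2) by (simp add: abs_mult)
  then have "\<bar>real_of_int n\<bar> < 1" 
    using mult_less_cancel_left_pos[of "2 * pi" "\<bar>real_of_int n\<bar>" 1] by simp
  then have "n = 0" by linarith
  then show ?thesis using n by simp
qed

lemma upscaled_edge_spoke: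
  assumes "i \<ge> 1"
  shows "spoke (upscaled_edge N i)" "outer_pt (upscaled_edge N i) = circle_pt (2 * pi / real N * real i)"
  unfolding upscaled_edge_def
  using spoke_star_edge[of "upscaled_vertex N" i] outer_pt_star_edge[of "upscaled_vertex N" i] assms
  by (auto simp: upscaled_vertex_def)

lemma inj_on_upscaled_edge: "inj_on (upscaled_edge N) {1..N}"
proof (rule inj_onI)
  fix i j assume ij: "i \<in> {1..N}" "j \<in> {1..N}" "upscaled_edge N i = upscaled_edge N j"
  let ?a = "\<lambda>i. 2 * pi / real N * real i"
  have "circle_pt (?a i) = circle_pt (?a j)"
    using upscaled_edge_spoke(2)[of i N] upscaled_edge_spoke(2)[of j N] ij by auto
  moreover have "\<bar>?a i - ?a j\<bar> < 2 * pi"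
  proof -
    have "?a i - ?a j = 2 * pi * ((real i - real j) / real N)"
      by (simp add: diff_divide_distrib algebra_simps)
    moreover have "\<bar>(real i - real j) / real N\<bar> < 1" using ij by auto
    then have "2 * pi * \<bar>(real i - real j) / real N\<bar> < 2 * pi * 1"
      by (intro mult_strict_left_mono) auto
    ultimately show ?thesis by (simp only: abs_mult mult_1_right) simp
  qed
  ultimately have "?a i = ?a j" by (rule circle_pt_inj)
  then show "i = j" using ij by simp
qed

text \<open>The instance of \<^const>\<open>center_height\<close> for the homogenized problem, with the factors \<open>s i\<close> of the
forcing terms pulled out.\<close>

definition hom_height :: "nat \<Rightarrow> (nat \<Rightarrow> real) \<Rightarrow> (nat \<Rightarrow> real) \<Rightarrow> (nat \<Rightarrow> real \<Rightarrow> real) \<Rightarrow> real \<Rightarrow> real" where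
  "hom_height N s \<kappa> Fb hb = ((\<Sum>i=1..N. s i * prim (prim (Fb i)) 1) + hb) / (\<Sum>i=1..N. s i * \<kappa> i)"

text \<open>The weight \<open>s i\<close> multiplies both the forcing and the conductivity, and therefore cancels in the
profile; it survives only in the central value.\<close>

lemma homogenized_solution_iff_profile:
  assumes N: "N \<ge> 1" and s: "\<And>i. i \<in> {1..N} \<Longrightarrow> s i > 0" and \<kappa>: "\<And>i. i \<in> {1..N} \<Longrightarrow> \<kappa> i > 0"
    and Fb: "\<And>i. i \<in> {1..N} \<Longrightarrow> Fb i \<in> L2"
  shows "homogenized_solution N s \<kappa> Fb hb p \<longleftrightarrow>
    (\<forall>i\<in>{1..N}. AE t in leb01. on_edge p (upscaled_edge N i) t
       = profile (\<lambda>t. Fb i t / \<kappa> i) (hom_height N s \<kappa> Fb hb) t)"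
proof -
  have "homogenized_solution N s \<kappa> Fb hb p \<longleftrightarrow>
      star_problem {1..N} (upscaled_edge N) (\<lambda>i. s i * \<kappa> i) (\<lambda>i t. s i * Fb i t) hb p"
    by (simp add: homogenized_solution_def star_problem_def upscaled_edges_eq mult.assoc)
  also have "\<dots> \<longleftrightarrow> (\<forall>i\<in>{1..N}. AE t in leb01. on_edge p (upscaled_edge N i) t
      = profile (\<lambda>t. s i * Fb i t / (s i * \<kappa> i))
          (center_height {1..N} (\<lambda>i. s i * \<kappa> i) (\<lambda>i t. s i * Fb i t) hb) t)"
    by (rule star_problem_iff_profile)
       (use N s \<kappa> Fb in \<open>auto simp: inj_on_upscaled_edge[simplified] upscaled_edge_spoke intro: L2_cmult\<close>)
  also have "center_height {1..N} (\<lambda>i. s i * \<kappa> i) (\<lambda>i t. s i * Fb i t) hb = hom_height N s \<kappa> Fb hb"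
    by (simp add: center_height_def hom_height_def prim_prim_cmult)
  also have "(\<forall>i\<in>{1..N}. AE t in leb01. on_edge p (upscaled_edge N i) t
      = profile (\<lambda>t. s i * Fb i t / (s i * \<kappa> i)) (hom_height N s \<kappa> Fb hb) t)
    \<longleftrightarrow> (\<forall>i\<in>{1..N}. AE t in leb01. on_edge p (upscaled_edge N i) t
      = profile (\<lambda>t. Fb i t / \<kappa> i) (hom_height N s \<kappa> Fb hb) t)"
  proof (rule ball_cong[OF refl])
    fix i assume "i \<in> {1..N}"
    then have "(\<lambda>t. s i * Fb i t / (s i * \<kappa> i)) = (\<lambda>t. Fb i t / \<kappa> i)"
      using s[of i] by auto
    then show "(AE t in leb01. on_edge p (upscaled_edge N i) t
          = profile (\<lambda>t. s i * Fb i t / (s i * \<kappa> i)) (hom_height N s \<kappa> Fb hb) t)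
      \<longleftrightarrow> (AE t in leb01. on_edge p (upscaled_edge N i) t
          = profile (\<lambda>t. Fb i t / \<kappa> i) (hom_height N s \<kappa> Fb hb) t)"
      by simp
  qed
  finally show ?thesis .
qed

text \<open>Both solutions are profiles, and their difference is the profile of the difference of the data.\<close>

lemma homogenized_stability:
  assumes N: "N \<ge> 1" and s: "\<And>i. i \<in> {1..N} \<Longrightarrow> s i > 0" and \<kappa>: "\<And>i. i \<in> {1..N} \<Longrightarrow> \<kappa> i > 0"
  shows "\<exists>L\<ge>0. (\<forall>Fb Fb' hb hb' p p'. (\<forall>i\<in>{1..N}. Fb i \<in> L2) \<longrightarrow> (\<forall>i\<in>{1..N}. Fb' i \<in> L2) \<longrightarrow>
      homogenized_solution N s \<kappa> Fb hb p \<longrightarrow> homogenized_solution N s \<kappa> Fb' hb' p' \<longrightarrow>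
      star_H1_norm (upscaled_edges N) (\<lambda>x. p' x - p x)
        \<le> L * sqrt ((\<Sum>i=1..N. (L2_norm (\<lambda>t. Fb' i t - Fb i t))\<^sup>2) + (hb' - hb)\<^sup>2))"
proof -
  define S where "S = (\<Sum>i=1..N. s i * \<kappa> i)"
  define \<sigma> where "\<sigma> = (\<Sum>i=1..N. s i)"
  have S: "S > 0" unfolding S_def using N s \<kappa> by (intro sum_pos) auto
  have \<sigma>: "\<sigma> \<ge> 0" unfolding \<sigma>_def using s by (intro sum_nonneg) (auto intro: less_imp_le)
  define L where "L i = 6 * (1 / \<kappa> i + (\<sigma> + 1) / S)" for i
  have L: "L i \<ge> 0" if "i \<in> {1..N}" for i
    using \<kappa>[OF that] S \<sigma> by (simp add: L_def)
  show ?thesis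
  proof (intro exI[of _ "\<Sum>i=1..N. L i"] conjI allI impI)
    show "(\<Sum>i=1..N. L i) \<ge> 0" using L by (intro sum_nonneg)
    fix Fb Fb' hb hb' p p'
    assume F: "\<forall>i\<in>{1..N}. Fb i \<in> L2" "\<forall>i\<in>{1..N}. Fb' i \<in> L2"
      and p: "homogenized_solution N s \<kappa> Fb hb p" and p': "homogenized_solution N s \<kappa> Fb' hb' p'"
    let ?d = "\<lambda>i t. Fb' i t - Fb i t"
    define D where "D = sqrt ((\<Sum>i=1..N. (L2_norm (?d i))\<^sup>2) + (hb' - hb)\<^sup>2)"
    have dL: "?d i \<in> L2" if "i \<in> {1..N}" for i
      using F that by (auto intro: L2_diff)
    have Di: "L2_norm (?d i) \<le> D" if "i \<in> {1..N}" for i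
    proof -
      have "(L2_norm (?d i))\<^sup>2 \<le> (\<Sum>i=1..N. (L2_norm (?d i))\<^sup>2)"
        by (rule member_le_sum[OF that]) auto
      then show ?thesis
        unfolding D_def using zero_le_power2[of "hb' - hb"] by (intro real_le_rsqrt) linarith
    qed
    have Dh: "\<bar>hb' - hb\<bar> \<le> D"
      unfolding D_def by (rule real_le_rsqrt) (simp add: sum_nonneg)
    have L1: "(LINT t|leb01. \<bar>?d i t\<bar>) \<le> D" if "i \<in> {1..N}" for i
      using LINT_abs_le_L2_norm[OF dL[OF that]] Di[OF that] by simp
    let ?c = "hom_height N s \<kappa> Fb hb" and ?c' = "hom_height N s \<kappa> Fb' hb'"
    have c: "\<bar>?c' - ?c\<bar> \<le> (\<sigma> + 1) / S * D"
    proof -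
      have "?c' - ?c = ((\<Sum>i=1..N. s i * prim (prim (?d i)) 1) + (hb' - hb)) / S"
      proof -
        have "(\<Sum>i=1..N. s i * prim (prim (?d i)) 1)
            = (\<Sum>i=1..N. s i * prim (prim (Fb' i)) 1) - (\<Sum>i=1..N. s i * prim (prim (Fb i)) 1)"
          unfolding sum_subtractf[symmetric]
          by (rule sum.cong) (use F in \<open>auto simp: prim_prim_diff L2_integrable right_diff_distrib\<close>)
        then show ?thesis
          by (simp add: hom_height_def S_def diff_divide_distrib add_divide_distrib)
      qed
      moreover have "\<bar>(\<Sum>i=1..N. s i * prim (prim (?d i)) 1) + (hb' - hb)\<bar> \<le> \<sigma> * D + D"
      proof -
        have "\<bar>\<Sum>i=1..N. s i * prim (prim (?d i)) 1\<bar> \<le> (\<Sum>i=1..N. s i * D)"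
        proof (rule order_trans[OF sum_abs sum_mono])
          fix i assume i: "i \<in> {1..N}"
          have "\<bar>prim (prim (?d i)) 1\<bar> \<le> D"
            using abs_prim_prim_le[OF L2_integrable[OF dL[OF i]], of 1] L1[OF i] by simp
          then show "\<bar>s i * prim (prim (?d i)) 1\<bar> \<le> s i * D"
            using s[OF i] by (simp add: abs_mult)
        qed
        then show ?thesis using Dh by (simp add: \<sigma>_def sum_distrib_right)
      qed
      ultimately show ?thesis using S by (simp add: divide_right_mono algebra_simps)
    qed
    have H: "H1_norm (on_edge (\<lambda>x. p' x - p x) (upscaled_edge N i)) \<le> L i * D" if i: "i \<in> {1..N}" for i
    proof -
      let ?g = "\<lambda>t. Fb' i t / \<kappa> i - Fb i t / \<kappa> i"
      have "AE t in leb01. on_edge p (upscaled_edge N i) t = profile (\<lambda>t. Fb i t / \<kappa> i) ?c t"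
        using p homogenized_solution_iff_profile[of N s \<kappa> Fb hb p] N s \<kappa> F i by blast
      moreover have "AE t in leb01. on_edge p' (upscaled_edge N i) t = profile (\<lambda>t. Fb' i t / \<kappa> i) ?c' t"
        using p' homogenized_solution_iff_profile[of N s \<kappa> Fb' hb' p'] N s \<kappa> F i by blast
      ultimately have "AE t in leb01. on_edge (\<lambda>x. p' x - p x) (upscaled_edge N i) t = profile ?g (?c' - ?c) t"
        by eventually_elim (use F i in \<open>simp add: on_edge_diff profile_diff L2_integrable\<close>)
      then have "H1_norm (on_edge (\<lambda>x. p' x - p x) (upscaled_edge N i)) \<le> 6 * ((LINT t|leb01. \<bar>?g t\<bar>) + \<bar>?c' - ?c\<bar>)"
        by (intro H1_norm_profile_le) (use F i in \<open>auto simp: L2_integrable\<close>)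
      also have "(LINT t|leb01. \<bar>?g t\<bar>) = (LINT t|leb01. \<bar>?d i t\<bar>) / \<kappa> i"
        using \<kappa>[OF i] by (simp add: diff_divide_distrib[symmetric])
      also have "\<dots> \<le> D / \<kappa> i"
        using L1[OF i] \<kappa>[OF i] by (simp add: divide_right_mono)
      also have "6 * (D / \<kappa> i + \<bar>?c' - ?c\<bar>) \<le> 6 * (D / \<kappa> i + (\<sigma> + 1) / S * D)"
        using c by simp
      also have "\<dots> = L i * D" by (simp add: L_def algebra_simps)
      finally show ?thesis by simp
    qed
    have "star_H1_norm (upscaled_edges N) (\<lambda>x. p' x - p x)
        = L2_set (\<lambda>i. H1_norm (on_edge (\<lambda>x. p' x - p x) (upscaled_edge N i))) {1..N}"
      by (simp add: star_H1_norm_def L2_set_def upscaled_edges_eq sum.reindex[OF inj_on_upscaled_edge, simplified])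
    also have "\<dots> \<le> (\<Sum>i=1..N. H1_norm (on_edge (\<lambda>x. p' x - p x) (upscaled_edge N i)))"
      by (rule L2_set_le_sum) (simp add: H1_norm_nonneg)
    also have "\<dots> \<le> (\<Sum>i=1..N. L i * D)" by (rule sum_mono) (rule H)
    finally show "star_H1_norm (upscaled_edges N) (\<lambda>x. p' x - p x) \<le> (\<Sum>i=1..N. L i) * sqrt ((\<Sum>i=1..N. (L2_norm (?d i))\<^sup>2) + (hb' - hb)\<^sup>2)"
      by (simp add: D_def sum_distrib_right)
  qed
qed

lemma homogenized_well_posedI:
  assumes N: "N \<ge> 1" and s: "\<And>i. i \<in> {1..N} \<Longrightarrow> s i > 0" and \<kappa>: "\<And>i. i \<in> {1..N} \<Longrightarrow> \<kappa> i > 0"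
  shows "homogenized_well_posed N s \<kappa>"
  unfolding homogenized_well_posed_def
proof (intro allI impI conjI ballI)
  fix Fb :: "nat \<Rightarrow> real \<Rightarrow> real" and hb assume F: "\<forall>i\<in>{1..N}. Fb i \<in> L2"
  then have iff: "homogenized_solution N s \<kappa> Fb hb p \<longleftrightarrow>
    (\<forall>i\<in>{1..N}. AE t in leb01. on_edge p (upscaled_edge N i) t
       = profile (\<lambda>t. Fb i t / \<kappa> i) (hom_height N s \<kappa> Fb hb) t)" for p
    by (intro homogenized_solution_iff_profile N s \<kappa>) auto
  show "\<exists>p. homogenized_solution N s \<kappa> Fb hb p"
  proof -
    have "\<exists>u. \<forall>i\<in>{1..N}. AE t in leb01. on_edge u (upscaled_edge N i) t
        = profile (\<lambda>t. Fb i t / \<kappa> i) (hom_height N s \<kappa> Fb hb) t"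
      by (rule ex_on_edges[OF inj_on_upscaled_edge upscaled_edge_spoke(1)]) simp
    then show ?thesis unfolding iff by blast
  qed
  show "AE t in leb01. on_edge p (upscaled_edge N i) t = on_edge p' (upscaled_edge N i) t"
    if "homogenized_solution N s \<kappa> Fb hb p \<and> homogenized_solution N s \<kappa> Fb hb p'" "i \<in> {1..N}" for p p' i
  proof -
    have "AE t in leb01. on_edge q (upscaled_edge N i) t
       = profile (\<lambda>t. Fb i t / \<kappa> i) (hom_height N s \<kappa> Fb hb) t" if "q = p \<or> q = p'" for q
      using \<open>_ \<and> _\<close> \<open>i \<in> {1..N}\<close> that unfolding iff by blast
    from this[of p] this[of p'] have
      "AE t in leb01. on_edge p (upscaled_edge N i) t = profile (\<lambda>t. Fb i t / \<kappa> i) (hom_height N s \<kappa> Fb hb) t"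
      "AE t in leb01. on_edge p' (upscaled_edge N i) t = profile (\<lambda>t. Fb i t / \<kappa> i) (hom_height N s \<kappa> Fb hb) t"
      by auto
    then show ?thesis by eventually_elim simp
  qed
  fix \<epsilon> :: real assume "\<epsilon> > 0"
  from homogenized_stability[of N s \<kappa>, OF N s \<kappa>]
  obtain L where L: "L \<ge> 0" and bd: "\<forall>Fb Fb' hb hb' p p'. (\<forall>i\<in>{1..N}. Fb i \<in> L2) \<longrightarrow> (\<forall>i\<in>{1..N}. Fb' i \<in> L2) \<longrightarrow>
      homogenized_solution N s \<kappa> Fb hb p \<longrightarrow> homogenized_solution N s \<kappa> Fb' hb' p' \<longrightarrow>
      star_H1_norm (upscaled_edges N) (\<lambda>x. p' x - p x)
        \<le> L * sqrt ((\<Sum>i=1..N. (L2_norm (\<lambda>t. Fb' i t - Fb i t))\<^sup>2) + (hb' - hb)\<^sup>2)"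
    by auto
  show "\<exists>\<delta>>0. \<forall>Fb' hb' p p'.
           (\<forall>i\<in>{1..N}. Fb' i \<in> L2) \<and>
           sqrt ((\<Sum>i=1..N. (L2_norm (\<lambda>t. Fb' i t - Fb i t))\<^sup>2) + (hb' - hb)\<^sup>2) < \<delta> \<and>
           homogenized_solution N s \<kappa> Fb hb p \<and> homogenized_solution N s \<kappa> Fb' hb' p' \<longrightarrow>
           star_H1_norm (upscaled_edges N) (\<lambda>x. p' x - p x) < \<epsilon>"
  proof (intro exI[of _ "\<epsilon> / (L + 1)"] conjI allI impI)
    show "\<epsilon> / (L + 1) > 0" using L \<open>\<epsilon> > 0\<close> by simp
    fix Fb' hb' p p'
    let ?D = "sqrt ((\<Sum>i=1..N. (L2_norm (\<lambda>t. Fb' i t - Fb i t))\<^sup>2) + (hb' - hb)\<^sup>2)"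
    assume a: "(\<forall>i\<in>{1..N}. Fb' i \<in> L2) \<and> ?D < \<epsilon> / (L + 1) \<and>
           homogenized_solution N s \<kappa> Fb hb p \<and> homogenized_solution N s \<kappa> Fb' hb' p'"
    then have "star_H1_norm (upscaled_edges N) (\<lambda>x. p' x - p x) \<le> L * ?D"
      using bd F by blast
    also have "\<dots> \<le> L * (\<epsilon> / (L + 1))"
      using a L by (intro mult_left_mono) auto
    also have "\<dots> < \<epsilon>" using L \<open>\<epsilon> > 0\<close> by (simp add: field_simps)
    finally show "star_H1_norm (upscaled_edges N) (\<lambda>x. p' x - p x) < \<epsilon>" .
  qed
qed


section \<open>Convergence of averages\<close>

text \<open>A case of Vitali's convergence theorem. Truncated at height \<open>R\<close>, the differences converge by
dominated convergence; the part above \<open>R\<close> is at most the square divided by \<open>R\<close>, which the \<open>L\<^sup>2\<close>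
bound makes uniformly small.\<close>

lemma LINT_abs_diff_tendsto_0:
  assumes f: "\<And>n. f n \<in> L2" and g: "g \<in> L2"
    and bd: "\<And>n::nat. (LINT t|leb01. (f n t)\<^sup>2) \<le> C"
    and ae: "AE t in leb01. (\<lambda>n. f n t) \<longlonglongrightarrow> g t"
  shows "(\<lambda>n. LINT t|leb01. \<bar>f n t - g t\<bar>) \<longlonglongrightarrow> 0"
proof (rule LIMSEQ_I)
  fix \<epsilon> :: real assume "\<epsilon> > 0"
  let ?d = "\<lambda>n t. \<bar>f n t - g t\<bar>"
  have dL: "(\<lambda>t. f n t - g t) \<in> L2" for n by (rule L2_diff[OF f g])
  define D where "D = 2 * C + 2 * (LINT t|leb01. (g t)\<^sup>2)"
  have D: "(LINT t|leb01. (?d n t)\<^sup>2) \<le> D" for n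
  proof -
    have "(LINT t|leb01. (?d n t)\<^sup>2) \<le> (LINT t|leb01. 2 * (f n t)\<^sup>2 + 2 * (g t)\<^sup>2)"
    proof (rule integral_mono)
      show "(?d n t)\<^sup>2 \<le> 2 * (f n t)\<^sup>2 + 2 * (g t)\<^sup>2" for t
        using zero_le_power2[of "f n t + g t"] by (simp add: power2_diff power2_sum)
    qed (use L2_square_integrable[OF dL] L2_square_integrable[OF f] L2_square_integrable[OF g] in auto)
    also have "\<dots> \<le> D"
      using L2_square_integrable[OF f] L2_square_integrable[OF g] bd[of n] by (simp add: D_def)
    finally show ?thesis .
  qed
  have "D \<ge> 0" using D[of 0] by (rule order_trans[rotated]) simp
  (* The summand 1 keeps R positive when D vanishes. *)
  define R where "R = (2 * D + 1) / \<epsilon>"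
  have "R > 0" using \<open>D \<ge> 0\<close> \<open>\<epsilon> > 0\<close> by (simp add: R_def)
  have "D / R < \<epsilon> / 2"
    using \<open>D \<ge> 0\<close> \<open>\<epsilon> > 0\<close> by (simp add: R_def field_simps)
  have dm: "?d n \<in> borel_measurable leb01" for n
    using L2_measurable[OF dL[of n]] by measurable
  have mi: "integrable leb01 (\<lambda>t. min (?d n t) R)" for n
    by (rule L2_integrable[OF L2I_bounded[of _ R]]) (use dm[of n] \<open>R > 0\<close> in \<open>auto simp: min_def\<close>)
  have "(\<lambda>n. LINT t|leb01. min (?d n t) R) \<longlonglongrightarrow> (LINT t|leb01. 0)"
  proof (rule integral_dominated_convergence[where w = "\<lambda>t. R"])
    show "AE t in leb01. (\<lambda>n. min (?d n t) R) \<longlonglongrightarrow> 0"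
      using ae
    proof eventually_elim
      case (elim t)
      then have "(\<lambda>n. \<bar>f n t - g t\<bar>) \<longlonglongrightarrow> 0"
        by (intro tendsto_rabs_zero) (simp add: LIM_zero)
      from tendsto_min[OF this tendsto_const[of R]] show ?case
        using \<open>R > 0\<close> by simp
    qed
    show "AE t in leb01. norm (min (?d n t) R) \<le> R" for n
      using \<open>R > 0\<close> by (auto simp: min_def)
  qed (use mi in auto)
  then have "\<forall>\<^sub>F n in sequentially. (LINT t|leb01. min (?d n t) R) < \<epsilon> / 2"
    using \<open>\<epsilon> > 0\<close> by (intro order_tendstoD(2)) auto
  then have "\<forall>\<^sub>F n in sequentially. norm ((LINT t|leb01. ?d n t) - 0) < \<epsilon>"
  proof eventually_elim
    case (elim n)
    have "(LINT t|leb01. ?d n t) \<le> (LINT t|leb01. min (?d n t) R + (?d n t)\<^sup>2 / R)"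
    proof (rule integral_mono)
      show "?d n t \<le> min (?d n t) R + (?d n t)\<^sup>2 / R" for t
      proof (cases "?d n t \<le> R")
        case False
        then have "R * ?d n t \<le> ?d n t * ?d n t" by (intro mult_right_mono) auto
        then have "?d n t \<le> (?d n t)\<^sup>2 / R"
          using \<open>R > 0\<close> by (simp add: field_simps power2_eq_square)
        then show ?thesis using \<open>R > 0\<close> by (simp add: min_def)
      qed (use \<open>R > 0\<close> in simp)
    qed (use L2_integrable[OF dL] L2_square_integrable[OF dL] mi in auto)
    also have "\<dots> = (LINT t|leb01. min (?d n t) R) + (LINT t|leb01. (?d n t)\<^sup>2) / R"
      using L2_square_integrable[OF dL] mi by simp
    also have "\<dots> \<le> (LINT t|leb01. min (?d n t) R) + D / R"
      using D[of n] \<open>R > 0\<close> by (intro add_left_mono divide_right_mono) auto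
    also have "\<dots> < \<epsilon>" using elim \<open>D / R < \<epsilon> / 2\<close> by linarith
    finally show ?case by simp
  qed
  then show "\<exists>n0. \<forall>n\<ge>n0. norm ((LINT t|leb01. ?d n t) - 0) < \<epsilon>"
    by (simp add: eventually_sequentially)
qed

text \<open>Convexity of the square; the bound also holds for the empty family, whose average is \<open>0\<close>.\<close>

lemma LINT_square_average_le:
  assumes f: "\<And>j. j \<in> J \<Longrightarrow> f j \<in> L2"
    and bd: "\<And>j. j \<in> J \<Longrightarrow> (LINT t|leb01. (f j t)\<^sup>2) \<le> C" and C: "C \<ge> 0"
  shows "(LINT t|leb01. ((\<Sum>j\<in>J. f j t) / real (card J))\<^sup>2) \<le> C"
proof (cases "card J = 0")
  case False
  let ?m = "real (card J)"
  have m: "?m > 0" using False by simp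
  have "(LINT t|leb01. ((\<Sum>j\<in>J. f j t) / ?m)\<^sup>2) \<le> (LINT t|leb01. (\<Sum>j\<in>J. (f j t)\<^sup>2) / ?m)"
  proof (rule integral_mono)
    show "integrable leb01 (\<lambda>t. ((\<Sum>j\<in>J. f j t) / ?m)\<^sup>2)"
      by (rule L2_square_integrable) (intro L2_divide L2_sum f)
    show "integrable leb01 (\<lambda>t. (\<Sum>j\<in>J. (f j t)\<^sup>2) / ?m)"
      using L2_square_integrable[OF f] by (intro integrable_divide Bochner_Integration.integrable_sum) auto
    fix t
    have "(\<Sum>j\<in>J. f j t)\<^sup>2 / ?m\<^sup>2 \<le> ((\<Sum>j\<in>J. (f j t)\<^sup>2) * ?m) / ?m\<^sup>2"
      by (intro divide_right_mono sum_squared_le_sum_of_squares) simp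
    then show "((\<Sum>j\<in>J. f j t) / ?m)\<^sup>2 \<le> (\<Sum>j\<in>J. (f j t)\<^sup>2) / ?m"
      using m by (simp add: power_divide power2_eq_square)
  qed
  also have "\<dots> = (\<Sum>j\<in>J. LINT t|leb01. (f j t)\<^sup>2) / ?m"
    using L2_square_integrable[OF f] by simp
  also have "\<dots> \<le> (\<Sum>j\<in>J. C) / ?m"
    using bd by (intro divide_right_mono sum_mono) auto
  also have "\<dots> = C" using m by simp
  finally show ?thesis .
qed (use C in simp)

lemma sum_abs_L1_tendsto_0:
  fixes g :: "nat \<Rightarrow> 'i \<Rightarrow> real \<Rightarrow> real"
  assumes g: "\<And>n i. i \<in> I \<Longrightarrow> integrable leb01 (g n i)"
    and lim: "\<And>i. i \<in> I \<Longrightarrow> (\<lambda>n. LINT t|leb01. \<bar>g n i t\<bar>) \<longlonglongrightarrow> 0"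
  shows "(\<lambda>n. LINT t|leb01. \<bar>\<Sum>i\<in>I. g n i t\<bar>) \<longlonglongrightarrow> 0"
proof (rule Lim_null_comparison)
  show "(\<lambda>n. \<Sum>i\<in>I. LINT t|leb01. \<bar>g n i t\<bar>) \<longlonglongrightarrow> 0"
    using tendsto_sum[OF lim] by simp
  show "\<forall>\<^sub>F n in sequentially. norm (LINT t|leb01. \<bar>\<Sum>i\<in>I. g n i t\<bar>) \<le> (\<Sum>i\<in>I. LINT t|leb01. \<bar>g n i t\<bar>)"
  proof (rule always_eventually, rule allI)
    fix n
    have "(LINT t|leb01. \<bar>\<Sum>i\<in>I. g n i t\<bar>) \<le> (LINT t|leb01. (\<Sum>i\<in>I. \<bar>g n i t\<bar>))"
      by (rule integral_mono) (use g in \<open>auto intro!: sum_abs\<close>)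
    also have "\<dots> = (\<Sum>i\<in>I. LINT t|leb01. \<bar>g n i t\<bar>)"
      using g by simp
    finally show "norm (LINT t|leb01. \<bar>\<Sum>i\<in>I. g n i t\<bar>) \<le> (\<Sum>i\<in>I. LINT t|leb01. \<bar>g n i t\<bar>)" by simp
  qed
qed

text \<open>Here \<open>r n\<close> is meant to be the relative frequency of a conductivity class among the first \<open>n\<close> edges.\<close>

lemma weighted_L1_tendsto_0:
  fixes f :: "nat \<Rightarrow> real \<Rightarrow> real"
  assumes f: "\<And>n. integrable leb01 (f n)" and g: "integrable leb01 g"
    and lim: "(\<lambda>n. LINT t|leb01. \<bar>f n t - g t\<bar>) \<longlonglongrightarrow> 0" and r: "r \<longlonglongrightarrow> s"
  shows "(\<lambda>n. LINT t|leb01. \<bar>r n * f n t - s * g t\<bar>) \<longlonglongrightarrow> 0"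
proof (rule Lim_null_comparison)
  let ?h = "\<lambda>n. \<bar>r n\<bar> * (LINT t|leb01. \<bar>f n t - g t\<bar>) + \<bar>r n - s\<bar> * (LINT t|leb01. \<bar>g t\<bar>)"
  have "?h \<longlonglongrightarrow> \<bar>s\<bar> * 0 + \<bar>s - s\<bar> * (LINT t|leb01. \<bar>g t\<bar>)"
    by (intro tendsto_intros lim r)
  then show "?h \<longlonglongrightarrow> 0" by simp
  show "\<forall>\<^sub>F n in sequentially. norm (LINT t|leb01. \<bar>r n * f n t - s * g t\<bar>) \<le> ?h n"
  proof (rule always_eventually, rule allI)
    fix n
    have "(LINT t|leb01. \<bar>r n * f n t - s * g t\<bar>) \<le> (LINT t|leb01. \<bar>r n\<bar> * \<bar>f n t - g t\<bar> + \<bar>r n - s\<bar> * \<bar>g t\<bar>)"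
    proof (rule integral_mono)
      fix t
      have "r n * f n t - s * g t = r n * (f n t - g t) + (r n - s) * g t"
        by (simp add: algebra_simps)
      then show "\<bar>r n * f n t - s * g t\<bar> \<le> \<bar>r n\<bar> * \<bar>f n t - g t\<bar> + \<bar>r n - s\<bar> * \<bar>g t\<bar>"
        by (metis abs_mult abs_triangle_ineq)
    qed (use f g in auto)
    also have "\<dots> = ?h n" using f g by simp
    finally show "norm (LINT t|leb01. \<bar>r n * f n t - s * g t\<bar>) \<le> ?h n" by simp
  qed
qed

lemma AE_edge_avg_profile:
  assumes A: "finite A" "A \<noteq> {}" and F: "\<And>e. e \<in> A \<Longrightarrow> on_edge F e \<in> L2"
    and p: "\<And>e. e \<in> A \<Longrightarrow> AE t in leb01. on_edge p e t = profile (\<lambda>t. on_edge F e t / k) c t"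
  shows "AE t in leb01. edge_avg A p t = profile (\<lambda>t. edge_avg A F t / k) c t"
proof -
  have "AE t in leb01. \<forall>e\<in>A. on_edge p e t = profile (\<lambda>t. on_edge F e t / k) c t"
    using p A by (intro AE_finite_allI) auto
  then show ?thesis
  proof eventually_elim
    case (elim t)
    have "edge_avg A p t = (\<Sum>e\<in>A. profile (\<lambda>t. on_edge F e t / k) c t) / real (card A)"
      using elim by (simp add: edge_avg_def)
    also have "\<dots> = profile (\<lambda>t. edge_avg A F t / k) c t"
      unfolding edge_avg_def by (rule profile_average) (use A F in \<open>auto simp: L2_integrable\<close>)
    finally show ?case .
  qed
qed


section \<open>Homogenization on star graphs\<close>

theorem theorem6:
  fixes v :: "nat \<Rightarrow> real^2"
    and F K :: "real^2 \<Rightarrow> real"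
    and Ke :: "(real^2) set \<Rightarrow> real"
    and h :: "nat \<Rightarrow> real"
    and N :: nat
    and \<kappa> s :: "nat \<Rightarrow> real"
    and B :: "nat \<Rightarrow> (real^2) set set"
    and Fb :: "nat \<Rightarrow> real \<Rightarrow> real"
    and hb :: real
    and pn :: "nat \<Rightarrow> real^2 \<Rightarrow> real"
  assumes v0: "v 0 = 0"
    and v_circle: "\<forall>n\<ge>1. norm (v n) = 1"
    and v_distinct: "inj_on v {1..}"
    and v_equi: "equidistributed_circle v"
    and F_L2: "\<forall>e\<in>limit_edges v. on_edge F e \<in> L2"
    and F_bdd: "bdd_above ((\<lambda>e. L2_norm (on_edge F e)) ` limit_edges v)"
    and K_Linf: "K \<in> Linf_edges (limit_edges v)"
    and K_pos: "bdd_below (K ` limit_domain v)" "(INF x\<in>limit_domain v. K x) > 0"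
    and K_edge: "\<forall>e\<in>limit_edges v. \<forall>x\<in>rel_interior e. K x = Ke e"
    and K_range: "Ke ` limit_edges v = \<kappa> ` {1..N}"
    and \<kappa>_distinct: "inj_on \<kappa> {1..N}"
    and B_def: "\<forall>i\<in>{1..N}. B i = {e \<in> limit_edges v. Ke e = \<kappa> i}"
    and K_avg: "\<forall>i\<in>{1..N}.
      (\<lambda>n. (\<Sum>e\<in>star_edges v n \<inter> B i. Ke e) / real n) \<longlonglongrightarrow> s i * \<kappa> i"
    and s_pos: "\<forall>i\<in>{1..N}. s i > 0"
    and s_sum: "(\<Sum>i=1..N. s i) = 1"
    and Fb_L2: "\<forall>i\<in>{1..N}. Fb i \<in> L2"
    and F_avg: "\<forall>i\<in>{1..N}. AE t in leb01.
      (\<lambda>n. edge_avg (star_edges v n \<inter> B i) F t) \<longlonglongrightarrow> Fb i t"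
    and h_lim: "(\<lambda>n. h n / real n) \<longlonglongrightarrow> hb"
    and pn_sol: "\<forall>n\<ge>1. stage_solution (star_edges v n) K F (h n) (pn n)"
  shows "homogenized_well_posed N s \<kappa>
    \<and> (\<exists>p. is_limit_function v pn p)
    \<and> (\<forall>pb. homogenized_solution N s \<kappa> Fb hb pb \<longrightarrow>
        (\<forall>i\<in>{1..N}.
          (\<lambda>n. H1_norm (\<lambda>t. edge_avg (star_edges v n \<inter> B i) (pn n) t
                             - on_edge pb (upscaled_edge N i) t)) \<longlonglongrightarrow> 0)
        \<and> (\<forall>p. is_limit_function v pn p \<longrightarrow>
            (\<forall>i\<in>{1..N}.
              (\<lambda>n. H1_norm (\<lambda>t. edge_avg (star_edges v n \<inter> B i) p t
                                 - on_edge pb (upscaled_edge N i) t)) \<longlonglongrightarrow> 0)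
            \<and> (\<lambda>n. H1_norm (\<lambda>t. (\<Sum>e\<in>star_edges v n. on_edge p e t) / real n
                                 - (\<Sum>i=1..N. s i * on_edge pb (upscaled_edge N i) t))) \<longlonglongrightarrow> 0))"
proof -
  let ?E = "star_edges v"
  define A where "A n i = ?E n \<inter> B i" for n i
  have N: "N \<ge> 1" using s_sum by (cases N) auto
  have sp: "s i > 0" if "i \<in> {1..N}" for i using s_pos that by blast

  have E_fin: "finite (?E n)" for n by (simp add: star_edges_def)
  have E_limit: "?E n \<subseteq> limit_edges v" for n by (auto simp: limit_edges_def)
  have E_mono: "?E m \<subseteq> ?E n" if "m \<le> n" for m n
    using that by (auto simp: star_edges_def)
  have spoke: "spoke e" if "e \<in> limit_edges v" for e
    using that v0 v_circle by (auto simp: limit_edges_def star_edges_def spoke_star_edge)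
  have E_ne: "?E n \<noteq> {}" if "n \<ge> 1" for n using that by (auto simp: star_edges_def)

  have inner: "t *\<^sub>R outer_pt e \<in> rel_interior e" if "e \<in> limit_edges v" "0 < t" "t < 1" for e t
  proof -
    note o = spoke_outer_pt[OF spoke[OF that(1)]]
    have ne: "0 \<noteq> outer_pt e" using o(1) by auto
    then have "t *\<^sub>R outer_pt e \<in> open_segment 0 (outer_pt e)"
      using that(2,3) by (auto simp: in_segment)
    also have "\<dots> = rel_interior (closed_segment 0 (outer_pt e))"
      using ne by (simp add: rel_interior_closed_segment)
    finally show ?thesis using o(2) by simp
  qed
  have K_on: "on_edge K e t = Ke e" if "e \<in> limit_edges v" "0 < t" "t < 1" for e t
    using K_edge inner[OF that] that(1) by (auto simp: on_edge_def)
  have Ke_pos: "Ke e > 0" if e: "e \<in> limit_edges v" for e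
  proof -
    let ?x = "(1/2) *\<^sub>R outer_pt e"
    have "?x \<in> rel_interior e" using inner[OF e, of "1/2"] by simp
    then have "?x \<in> limit_domain v" using e by (auto simp: limit_domain_def)
    from cINF_lower[OF K_pos(1) this] K_pos(2) have "K ?x > 0" by simp
    then show ?thesis using K_edge e \<open>?x \<in> rel_interior e\<close> by auto
  qed
  have \<kappa>p: "\<kappa> i > 0" if i: "i \<in> {1..N}" for i
  proof -
    have "\<kappa> i \<in> Ke ` limit_edges v" using K_range i by auto
    then show ?thesis using Ke_pos by auto
  qed
  have FL: "on_edge F e \<in> L2" if "e \<in> limit_edges v" for e using F_L2 that by blast

  (* E_n is the disjoint union of the classes, whose relative frequencies r n i tend to s i > 0; in
     particular no class stays empty. *)
  have A_fin: "finite (A n i)" for n i using E_fin by (simp add: A_def)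
  have A_limit: "e \<in> limit_edges v" if "e \<in> A n i" for e n i
    using that E_limit by (auto simp: A_def)
  have A_Ke: "Ke e = \<kappa> i" if "e \<in> A n i" "i \<in> {1..N}" for e n i
    using that B_def by (auto simp: A_def)
  have E_split: "(\<Sum>e\<in>?E n. g e) = (\<Sum>i=1..N. \<Sum>e\<in>A n i. g e)" for n and g :: "(real^2) set \<Rightarrow> real"
  proof -
    have "?E n = (\<Union>i\<in>{1..N}. A n i)"
    proof
      show "?E n \<subseteq> (\<Union>i\<in>{1..N}. A n i)"
      proof
        fix e assume e: "e \<in> ?E n"
        then have "Ke e \<in> \<kappa> ` {1..N}" using E_limit K_range by blast
        then obtain i where "i \<in> {1..N}" "Ke e = \<kappa> i" by auto
        then show "e \<in> (\<Union>i\<in>{1..N}. A n i)" using e E_limit B_def by (auto simp: A_def)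
      qed
    qed (auto simp: A_def)
    moreover have "A n i \<inter> A n j = {}" if "i \<in> {1..N}" "j \<in> {1..N}" "i \<noteq> j" for i j
      using A_Ke[OF _ that(1), of _ n] A_Ke[OF _ that(2), of _ n] inj_on_eq_iff[OF \<kappa>_distinct that(1,2)] that(3)
      by fastforce
    ultimately show ?thesis
      using A_fin by (simp only:) (rule sum.UNION_disjoint, auto)
  qed
  define r where "r n i = real (card (A n i)) / real n" for n i
  have r_lim: "(\<lambda>n. r n i) \<longlonglongrightarrow> s i" if i: "i \<in> {1..N}" for i
  proof -
    have "(\<lambda>n. (\<Sum>e\<in>A n i. Ke e) / real n / \<kappa> i) \<longlonglongrightarrow> s i * \<kappa> i / \<kappa> i"
      using K_avg i \<kappa>p[OF i] by (intro tendsto_divide tendsto_const) (auto simp: A_def)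
    moreover have "(\<Sum>e\<in>A n i. Ke e) / real n / \<kappa> i = r n i" for n
      using A_Ke[OF _ i, of _ n] \<kappa>p[OF i] by (simp add: r_def)
    ultimately show ?thesis using \<kappa>p[OF i] by simp
  qed
  have A_ne: "\<forall>\<^sub>F n in sequentially. \<forall>i\<in>{1..N}. A n i \<noteq> {}"
  proof (intro eventually_ball_finite ballI)
    fix i assume i: "i \<in> {1..N}"
    have "\<forall>\<^sub>F n in sequentially. r n i > 0"
      using order_tendstoD(1)[OF r_lim[OF i] sp[OF i]] .
    then show "\<forall>\<^sub>F n in sequentially. A n i \<noteq> {}"
      by eventually_elim (auto simp: r_def)
  qed simp

  (* The hypothesis gives pointwise convergence only; the uniform L2 bound upgrades it to L1. *)
  let ?G = "\<lambda>n i. edge_avg (A n i) F"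
  have GL: "?G n i \<in> L2" for n i
    unfolding edge_avg_def[abs_def] by (intro L2_divide L2_sum FL A_limit)
  have FbL: "Fb i \<in> L2" if "i \<in> {1..N}" for i using Fb_L2 that by blast
  obtain M where M: "\<And>e. e \<in> limit_edges v \<Longrightarrow> L2_norm (on_edge F e) \<le> M"
    using F_bdd by (auto simp: bdd_above_def)
  have F2: "(LINT t|leb01. (on_edge F e t)\<^sup>2) \<le> M\<^sup>2" if "e \<in> limit_edges v" for e
    using M[OF that] unfolding L2_norm_def by (rule sqrt_le_D)
  have G_lim: "(\<lambda>n. LINT t|leb01. \<bar>?G n i t - Fb i t\<bar>) \<longlonglongrightarrow> 0" if i: "i \<in> {1..N}" for i
  proof (rule LINT_abs_diff_tendsto_0[OF GL FbL[OF i]])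
    show "(LINT t|leb01. (?G n i t)\<^sup>2) \<le> M\<^sup>2" for n
      unfolding edge_avg_def by (rule LINT_square_average_le) (auto intro: FL F2 A_limit)
    show "AE t in leb01. (\<lambda>n. ?G n i t) \<longlonglongrightarrow> Fb i t"
      using F_avg i by (simp add: A_def)
  qed

  (* Numerator and denominator of the central value both grow like n, so they are divided by n. *)
  define c where "c n = center_height (?E n) Ke (on_edge F) (h n)" for n
  let ?c = "hom_height N s \<kappa> Fb hb"
  have c_lim: "c \<longlonglongrightarrow> ?c"
  proof -
    let ?I = "\<lambda>f. prim (prim f) 1"
    have I_lim: "(\<lambda>n. ?I (?G n i)) \<longlonglongrightarrow> ?I (Fb i)" if i: "i \<in> {1..N}" for i
    proof (rule LIM_zero_cancel, rule Lim_null_comparison[OF _ G_lim[OF i]], rule always_eventually, rule allI)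
      fix n
      show "norm (?I (?G n i) - ?I (Fb i)) \<le> (LINT t|leb01. \<bar>?G n i t - Fb i t\<bar>)"
        using abs_prim_prim_le[OF L2_integrable[OF L2_diff[OF GL FbL[OF i]]], of n i 1]
        by (simp add: prim_prim_diff L2_integrable GL FbL[OF i])
    qed
    have I_sum: "(\<Sum>e\<in>A n i. ?I (on_edge F e)) / real n = r n i * ?I (?G n i)" for n i
    proof -
      have "?I (?G n i) = ?I (\<lambda>t. (1 / real (card (A n i))) * (\<Sum>e\<in>A n i. on_edge F e t))"
        by (simp add: edge_avg_def[abs_def])
      also have "\<dots> = (\<Sum>e\<in>A n i. ?I (on_edge F e)) / real (card (A n i))"
        unfolding prim_prim_cmult by (subst prim_prim_sum) (auto intro: L2_integrable FL A_limit)
      finally show ?thesis using A_fin[of n i] by (cases "A n i = {}") (simp_all add: r_def)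
    qed
    have num: "(\<lambda>n. (\<Sum>e\<in>?E n. ?I (on_edge F e)) / real n) \<longlonglongrightarrow> (\<Sum>i=1..N. s i * ?I (Fb i))"
      unfolding E_split sum_divide_distrib[where A = "{1..N}"] I_sum
      by (intro tendsto_sum tendsto_mult r_lim I_lim)
    have den: "(\<lambda>n. (\<Sum>e\<in>?E n. Ke e) / real n) \<longlonglongrightarrow> (\<Sum>i=1..N. s i * \<kappa> i)"
      unfolding E_split sum_divide_distrib
      using K_avg by (intro tendsto_sum) (auto simp: A_def sum_divide_distrib)
    have "(\<Sum>i=1..N. s i * \<kappa> i) > 0" using N sp \<kappa>p by (intro sum_pos) auto
    then have "(\<lambda>n. ((\<Sum>e\<in>?E n. ?I (on_edge F e)) / real n + h n / real n) / ((\<Sum>e\<in>?E n. Ke e) / real n)) \<longlonglongrightarrow> ?c"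
      unfolding hom_height_def by (intro tendsto_intros num den h_lim) simp
    then show ?thesis
    proof (rule Lim_transform_eventually)
      show "\<forall>\<^sub>F n in sequentially. ((\<Sum>e\<in>?E n. ?I (on_edge F e)) / real n + h n / real n) / ((\<Sum>e\<in>?E n. Ke e) / real n) = c n"
        using eventually_gt_at_top[of 0]
        by eventually_elim (simp add: c_def center_height_def add_divide_distrib[symmetric])
    qed
  qed

  let ?P = "\<lambda>e. profile (\<lambda>t. on_edge F e t / Ke e)"
  have FK: "integrable leb01 (\<lambda>t. on_edge F e t / Ke e)" if "e \<in> limit_edges v" for e
    using L2_integrable[OF FL[OF that]] by simp
  have pn: "AE t in leb01. on_edge (pn n) e t = ?P e (c n) t" if "n \<ge> 1" "e \<in> ?E n" for n e
  proof -
    have "stage_solution (?E n) K F (h n) (pn n) \<longleftrightarrow> (\<forall>e\<in>?E n. AE t in leb01. on_edge (pn n) e t = ?P e (c n) t)"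
      unfolding c_def
      by (rule stage_solution_iff_profile)
         (use that E_ne E_fin E_limit[of n] in \<open>auto intro!: spoke K_on Ke_pos FL\<close>)
    then show ?thesis using pn_sol that by blast
  qed
  have pn_lim: "(\<lambda>n. H1_norm (\<lambda>t. on_edge (pn n) e t - u t)) \<longlonglongrightarrow> 0"
    if e: "e \<in> limit_edges v" and u: "AE t in leb01. u t = ?P e ?c t" for e u
  proof (rule H1_norm_profile_tendsto_0[where g = "\<lambda>_ t. on_edge F e t / Ke e - on_edge F e t / Ke e" and c = "\<lambda>n. c n - ?c"])
    from e obtain m where m: "e \<in> ?E m" by (auto simp: limit_edges_def)
    show "\<forall>\<^sub>F n in sequentially. AE t in leb01. on_edge (pn n) e t - u t
        = profile (\<lambda>t. on_edge F e t / Ke e - on_edge F e t / Ke e) (c n - ?c) t"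
      using eventually_ge_at_top[of "max 1 m"]
    proof eventually_elim
      case (elim n)
      then have "n \<ge> 1" "e \<in> ?E n" using E_mono[of m n] m by auto
      from pn[OF this] u show ?case
        by eventually_elim (simp only: profile_diff[OF FK[OF e] FK[OF e]])
    qed
  qed (use c_lim in \<open>auto intro: LIM_zero\<close>)

  have exist: "\<exists>p. is_limit_function v pn p"
  proof -
    have "\<exists>p. \<forall>e\<in>limit_edges v. AE t in leb01. on_edge p ((\<lambda>e. e) e) t = ?P e ?c t"
      by (rule ex_on_edges) (auto simp: spoke)
    then obtain p where p: "\<forall>e\<in>limit_edges v. AE t in leb01. on_edge p e t = ?P e ?c t"
      by auto
    have "on_edge p e \<in> H1" if e: "e \<in> limit_edges v" for e
      by (rule AE_prim_imp_H1(1)[OF slope_L2[OF FK[OF e]]]) (use p e in \<open>auto simp: profile_def\<close>)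
    then have "is_limit_function v pn p"
      unfolding is_limit_function_def using pn_lim p by blast
    then show ?thesis by blast
  qed

  (* The two limits, in H1 along a fixed edge, of the same sequence agree. *)
  have limit: "AE t in leb01. on_edge p e t = ?P e ?c t"
    if p: "is_limit_function v pn p" and e: "e \<in> limit_edges v" for p e
  proof (rule H1_limit_AE_unique)
    from e obtain m where m: "e \<in> ?E m" by (auto simp: limit_edges_def)
    show "on_edge p e \<in> L2" using p e by (auto simp: is_limit_function_def H1_def)
    show "?P e ?c \<in> L2" by (rule profile_L2[OF FK[OF e]])
    show "\<forall>\<^sub>F n in sequentially. on_edge (pn n) e \<in> L2"
      using eventually_ge_at_top[of "max 1 m"]
    proof eventually_elim
      case (elim n)
      then have "n \<ge> 1" "e \<in> ?E n" using E_mono[of m n] m by auto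
      from pn[OF this] show ?case by (rule L2_AE_cong[OF profile_L2[OF FK[OF e]]])
    qed
    show "(\<lambda>n. H1_norm (\<lambda>t. on_edge (pn n) e t - on_edge p e t)) \<longlonglongrightarrow> 0"
      using p e by (auto simp: is_limit_function_def)
    show "(\<lambda>n. H1_norm (\<lambda>t. on_edge (pn n) e t - ?P e ?c t)) \<longlonglongrightarrow> 0"
      by (rule pn_lim[OF e]) simp
  qed

  (* Stated for general functions q n and central values d n: it serves both the solutions pn n, with
     d = c, and the limit function, with d constant. *)
  have class_avg: "(\<lambda>n. H1_norm (\<lambda>t. edge_avg (A n i) (q n) t - on_edge pb (upscaled_edge N i) t)) \<longlonglongrightarrow> 0"
    if pb: "AE t in leb01. on_edge pb (upscaled_edge N i) t = profile (\<lambda>t. Fb i t / \<kappa> i) ?c t"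
      and i: "i \<in> {1..N}" and d: "d \<longlonglongrightarrow> ?c"
      and q: "\<And>n e. n \<ge> 1 \<Longrightarrow> e \<in> ?E n \<Longrightarrow> AE t in leb01. on_edge (q n) e t = ?P e (d n) t"
    for pb i d q
  proof (rule H1_norm_profile_tendsto_0[where g = "\<lambda>n t. ?G n i t / \<kappa> i - Fb i t / \<kappa> i" and c = "\<lambda>n. d n - ?c"])
    show "integrable leb01 (\<lambda>t. ?G n i t / \<kappa> i - Fb i t / \<kappa> i)" for n
      using L2_integrable[OF GL] L2_integrable[OF FbL[OF i]] by simp
    have "(\<lambda>n. (LINT t|leb01. \<bar>?G n i t - Fb i t\<bar>) / \<kappa> i) \<longlonglongrightarrow> 0"
      using tendsto_divide_zero[OF G_lim[OF i]] .
    then show "(\<lambda>n. LINT t|leb01. \<bar>?G n i t / \<kappa> i - Fb i t / \<kappa> i\<bar>) \<longlonglongrightarrow> 0"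
      using \<kappa>p[OF i] by (simp add: diff_divide_distrib[symmetric])
    show "(\<lambda>n. d n - ?c) \<longlonglongrightarrow> 0" using d by (rule LIM_zero)
    show "\<forall>\<^sub>F n in sequentially. AE t in leb01. edge_avg (A n i) (q n) t - on_edge pb (upscaled_edge N i) t
        = profile (\<lambda>t. ?G n i t / \<kappa> i - Fb i t / \<kappa> i) (d n - ?c) t"
      using A_ne eventually_ge_at_top[of 1]
    proof eventually_elim
      case (elim n)
      have "AE t in leb01. edge_avg (A n i) (q n) t = profile (\<lambda>t. ?G n i t / \<kappa> i) (d n) t"
      proof (rule AE_edge_avg_profile[OF A_fin])
        fix e assume e: "e \<in> A n i"
        then show "on_edge F e \<in> L2" by (intro FL A_limit)
        show "AE t in leb01. on_edge (q n) e t = profile (\<lambda>t. on_edge F e t / \<kappa> i) (d n) t"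
          using q[OF elim(2), of e] e A_Ke[OF e i] by (simp add: A_def)
      qed (use elim i in auto)
      with pb show ?case
        by eventually_elim (use L2_integrable[OF GL] L2_integrable[OF FbL[OF i]] in \<open>simp add: profile_diff\<close>)
    qed
  qed

  (* The classes have different conductivities, but profiles add up across classes since the
     conductivity has been divided into the forcing. *)
  have total_avg: "(\<lambda>n. H1_norm (\<lambda>t. (\<Sum>e\<in>?E n. on_edge p e t) / real n
        - (\<Sum>i=1..N. s i * on_edge pb (upscaled_edge N i) t))) \<longlonglongrightarrow> 0"
    if pb: "\<And>i. i \<in> {1..N} \<Longrightarrow> AE t in leb01. on_edge pb (upscaled_edge N i) t = profile (\<lambda>t. Fb i t / \<kappa> i) ?c t"
      and p: "\<And>e. e \<in> limit_edges v \<Longrightarrow> AE t in leb01. on_edge p e t = ?P e ?c t"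
    for pb p
  proof -
    let ?g = "\<lambda>n i t. r n i * (?G n i t / \<kappa> i) - s i * (Fb i t / \<kappa> i)"
    have Gi: "integrable leb01 (\<lambda>t. ?G n i t / \<kappa> i)" for n i
      using L2_integrable[OF GL] by simp
    have Fi: "integrable leb01 (\<lambda>t. Fb i t / \<kappa> i)" if "i \<in> {1..N}" for i
      using L2_integrable[OF FbL[OF that]] by simp
    have gi: "integrable leb01 (?g n i)" if "i \<in> {1..N}" for n i
      using Gi Fi[OF that] by (intro Bochner_Integration.integrable_diff integrable_mult_right)
    show ?thesis
    proof (rule H1_norm_profile_tendsto_0[where g = "\<lambda>n t. \<Sum>i=1..N. ?g n i t" and c = "\<lambda>n. \<Sum>i=1..N. r n i * ?c - s i * ?c"])
      show "integrable leb01 (\<lambda>t. \<Sum>i=1..N. ?g n i t)" for n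
        using gi by (intro Bochner_Integration.integrable_sum)
      show "(\<lambda>n. LINT t|leb01. \<bar>\<Sum>i=1..N. ?g n i t\<bar>) \<longlonglongrightarrow> 0"
      proof (rule sum_abs_L1_tendsto_0[OF gi])
        fix i assume i: "i \<in> {1..N}"
        show "(\<lambda>n. LINT t|leb01. \<bar>?g n i t\<bar>) \<longlonglongrightarrow> 0"
        proof (rule weighted_L1_tendsto_0[OF Gi Fi[OF i] _ r_lim[OF i]])
          have "(\<lambda>n. (LINT t|leb01. \<bar>?G n i t - Fb i t\<bar>) / \<kappa> i) \<longlonglongrightarrow> 0"
            using tendsto_divide_zero[OF G_lim[OF i]] .
          then show "(\<lambda>n. LINT t|leb01. \<bar>?G n i t / \<kappa> i - Fb i t / \<kappa> i\<bar>) \<longlonglongrightarrow> 0"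
            using \<kappa>p[OF i] by (simp add: diff_divide_distrib[symmetric])
        qed
      qed
      have "(\<lambda>n. \<Sum>i=1..N. r n i * ?c - s i * ?c) \<longlonglongrightarrow> (\<Sum>i=1..N. s i * ?c - s i * ?c)"
        by (intro tendsto_intros r_lim)
      then show "(\<lambda>n. \<Sum>i=1..N. r n i * ?c - s i * ?c) \<longlonglongrightarrow> 0" by simp
      show "\<forall>\<^sub>F n in sequentially. AE t in leb01. (\<Sum>e\<in>?E n. on_edge p e t) / real n
          - (\<Sum>i=1..N. s i * on_edge pb (upscaled_edge N i) t)
        = profile (\<lambda>t. \<Sum>i=1..N. ?g n i t) (\<Sum>i=1..N. r n i * ?c - s i * ?c) t"
        using A_ne
      proof eventually_elim
        case (elim n)
        have "AE t in leb01. edge_avg (A n i) p t = profile (\<lambda>t. ?G n i t / \<kappa> i) ?c t" if i: "i \<in> {1..N}" for i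
        proof (rule AE_edge_avg_profile[OF A_fin])
          fix e assume e: "e \<in> A n i"
          then show "on_edge F e \<in> L2" by (intro FL A_limit)
          show "AE t in leb01. on_edge p e t = profile (\<lambda>t. on_edge F e t / \<kappa> i) ?c t"
            using p[OF A_limit[OF e]] A_Ke[OF e i] by simp
        qed (use elim i in auto)
        then have "AE t in leb01. \<forall>i\<in>{1..N}. edge_avg (A n i) p t = profile (\<lambda>t. ?G n i t / \<kappa> i) ?c t"
          by (intro AE_finite_allI) auto
        moreover have "AE t in leb01. \<forall>i\<in>{1..N}. on_edge pb (upscaled_edge N i) t = profile (\<lambda>t. Fb i t / \<kappa> i) ?c t"
          using pb by (intro AE_finite_allI) auto
        ultimately show ?case
        proof eventually_elim
          case (elim t)
          have "(\<Sum>e\<in>?E n. on_edge p e t) / real n = (\<Sum>i=1..N. r n i * edge_avg (A n i) p t)"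
            unfolding E_split sum_divide_distrib
          proof (rule sum.cong[OF refl])
            fix i
            show "(\<Sum>e\<in>A n i. on_edge p e t / real n) = r n i * edge_avg (A n i) p t"
              using A_fin[of n i]
              by (cases "A n i = {}") (simp_all add: r_def edge_avg_def sum_divide_distrib[symmetric])
          qed
          then have "(\<Sum>e\<in>?E n. on_edge p e t) / real n - (\<Sum>i=1..N. s i * on_edge pb (upscaled_edge N i) t)
              = (\<Sum>i=1..N. r n i * profile (\<lambda>t. ?G n i t / \<kappa> i) ?c t - s i * profile (\<lambda>t. Fb i t / \<kappa> i) ?c t)"
            using elim by (simp add: sum_subtractf)
          also have "\<dots> = (\<Sum>i=1..N. profile (?g n i) (r n i * ?c - s i * ?c) t)"
          proof (rule sum.cong[OF refl])
            fix i assume i: "i \<in> {1..N}"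
            show "r n i * profile (\<lambda>t. ?G n i t / \<kappa> i) ?c t - s i * profile (\<lambda>t. Fb i t / \<kappa> i) ?c t
                = profile (?g n i) (r n i * ?c - s i * ?c) t"
              unfolding profile_cmult[symmetric]
              by (intro profile_diff[symmetric] integrable_mult_right Gi Fi[OF i])
          qed
          also have "\<dots> = profile (\<lambda>t. \<Sum>i=1..N. ?g n i t) (\<Sum>i=1..N. r n i * ?c - s i * ?c) t"
            by (rule profile_sum[symmetric]) (rule gi)
          finally show ?case .
        qed
      qed
    qed
  qed

  show ?thesis
  proof (intro conjI allI impI ballI)
    show "homogenized_well_posed N s \<kappa>" by (rule homogenized_well_posedI[of N s \<kappa>, OF N sp \<kappa>p])
    show "\<exists>p. is_limit_function v pn p" by (rule exist)
  next
    fix pb assume "homogenized_solution N s \<kappa> Fb hb pb"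
    then have pb: "AE t in leb01. on_edge pb (upscaled_edge N i) t = profile (\<lambda>t. Fb i t / \<kappa> i) ?c t"
      if "i \<in> {1..N}" for i
      using homogenized_solution_iff_profile[of N s \<kappa> Fb hb pb, OF N sp \<kappa>p FbL] that by blast
    show "(\<lambda>n. H1_norm (\<lambda>t. edge_avg (?E n \<inter> B i) (pn n) t
          - on_edge pb (upscaled_edge N i) t)) \<longlonglongrightarrow> 0" if i: "i \<in> {1..N}" for i
      using class_avg[OF pb[OF i] i c_lim pn] by (simp add: A_def)
    fix p assume p: "is_limit_function v pn p"
    show "(\<lambda>n. H1_norm (\<lambda>t. edge_avg (?E n \<inter> B i) p t
          - on_edge pb (upscaled_edge N i) t)) \<longlonglongrightarrow> 0" if i: "i \<in> {1..N}" for i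
      using class_avg[OF pb[OF i] i tendsto_const, of "\<lambda>_. p"] limit[OF p] E_limit
      by (auto simp: A_def)
    show "(\<lambda>n. H1_norm (\<lambda>t. (\<Sum>e\<in>?E n. on_edge p e t) / real n
        - (\<Sum>i=1..N. s i * on_edge pb (upscaled_edge N i) t))) \<longlonglongrightarrow> 0"
      by (rule total_avg[OF pb limit[OF p]])
  qed
qed

end
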